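(* Let $G$ be a metrizable totally disconnected, locally compact group, and suppose that $G^\dagger$ is dense in $G$; equivalently, in every non-trivial Hausdorff quotient $G/N$ of $G$, some element has non-trivial contraction group. Let $H$ be a closed subgroup of $G$ of finite covolume. Then $H$ acts ergodically on $G/H$ by left translation.
   Context: Topological groups are Hausdorff. For an element $g$ of a topological group $G$, the contraction group is $\mathrm{con}(g) = \{x \in G \mid g^n x g^{-n} \to 1 \text{ as } n \to +\infty\}$; the Tits core is the abstract subgroup $G^\dagger := \langle \overline{\mathrm{con}(g)} \mid g \in G\rangle$. A closed subgroup $H \le G$ has finite covolume if $G/H$ carries a $G$-invariant Borel probability measure; ergodicity is with respect to this measure.
   Formalization: The G-invariant Borel probability measure on G/H is required to be Radon (inner regular by compact sets); this is automatic for second countable G, and without it the measure need not be unique and ergodicity can fail if a real-valued measurable cardinal exists. *)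

theory Defs
  imports "HOL-Probability.Probability_Measure" "HOL-Algebra.Coset" "HOL-Algebra.Left_Coset"
    "HOL-Algebra.Generated_Groups"
begin

section \<open>Topological groups\<close>

locale topological_group = group G for G (structure) +
  fixes T :: "'a topology"
  assumes topspace_eq: "topspace T = carrier G"
    and continuous_mult: "continuous_map (prod_topology T T) T (\<lambda>(x, y). x \<otimes> y)"
    and continuous_inv: "continuous_map T T (\<lambda>x. inv x)"
    and Hausdorff: "Hausdorff_space T"

definition totally_disconnected_space :: "'a topology \<Rightarrow> bool" where
  "totally_disconnected_space X \<longleftrightarrow> (\<forall>S. connectedin X S \<longrightarrow> (\<exists>a. S \<subseteq> {a}))"

locale tdlc_group = topological_group +
  assumes totally_disconnected: "totally_disconnected_space T"
    and locally_compact: "locally_compact_space T"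

definition contraction_group ::
    "('a, 'b) monoid_scheme \<Rightarrow> 'a topology \<Rightarrow> 'a \<Rightarrow> 'a set" where
  "contraction_group G T g =
     {x \<in> carrier G.
        limitin T (\<lambda>n::nat. (g [^]\<^bsub>G\<^esub> n) \<otimes>\<^bsub>G\<^esub> x \<otimes>\<^bsub>G\<^esub> inv\<^bsub>G\<^esub> (g [^]\<^bsub>G\<^esub> n)) \<one>\<^bsub>G\<^esub> sequentially}"

definition Tits_core :: "('a, 'b) monoid_scheme \<Rightarrow> 'a topology \<Rightarrow> 'a set" where
  "Tits_core G T = generate G (\<Union>g\<in>carrier G. T closure_of contraction_group G T g)"


section \<open>Quotients\<close>

definition quotient_topology :: "'a topology \<Rightarrow> ('a \<Rightarrow> 'b) \<Rightarrow> 'b topology" where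
  "quotient_topology X f =
     topology (\<lambda>U. U \<subseteq> f ` topspace X \<and> openin X {x \<in> topspace X. f x \<in> U})"

lemma openin_quotient_topology:
  "openin (quotient_topology X f) U \<longleftrightarrow>
     U \<subseteq> f ` topspace X \<and> openin X {x \<in> topspace X. f x \<in> U}"
proof -
  have "istopology (\<lambda>U. U \<subseteq> f ` topspace X \<and> openin X {x \<in> topspace X. f x \<in> U})"
    unfolding istopology_def
  proof (intro conjI allI impI)
    fix S U
    assume *: "S \<subseteq> f ` topspace X \<and> openin X {x \<in> topspace X. f x \<in> S}"
      "U \<subseteq> f ` topspace X \<and> openin X {x \<in> topspace X. f x \<in> U}"
    have "{x \<in> topspace X. f x \<in> S \<inter> U} =
        {x \<in> topspace X. f x \<in> S} \<inter> {x \<in> topspace X. f x \<in> U}"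
      by auto
    moreover have "openin X ({x \<in> topspace X. f x \<in> S} \<inter> {x \<in> topspace X. f x \<in> U})"
      by (rule openin_Int) (use * in blast)+
    ultimately show "openin X {x \<in> topspace X. f x \<in> S \<inter> U}"
      by (rule ssubst)
    from * show "S \<inter> U \<subseteq> f ` topspace X" by auto
  next
    fix K
    assume *: "\<forall>S\<in>K. S \<subseteq> f ` topspace X \<and> openin X {x \<in> topspace X. f x \<in> S}"
    have "{x \<in> topspace X. f x \<in> \<Union>K} = \<Union>((\<lambda>S. {x \<in> topspace X. f x \<in> S}) ` K)"
      by auto
    moreover have "openin X (\<Union>((\<lambda>S. {x \<in> topspace X. f x \<in> S}) ` K))"
      by (rule openin_Union) (use * in blast)
    ultimately show "openin X {x \<in> topspace X. f x \<in> \<Union>K}"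
      by (rule ssubst)
    from * show "\<Union>K \<subseteq> f ` topspace X" by auto
  qed
  then show ?thesis
    unfolding quotient_topology_def by (simp only: topology_inverse')
qed

lemma topspace_quotient_topology: "topspace (quotient_topology X f) = f ` topspace X"
proof (rule subset_antisym)
  have "openin (quotient_topology X f) (topspace (quotient_topology X f))"
    by (rule openin_topspace)
  then show "topspace (quotient_topology X f) \<subseteq> f ` topspace X"
    unfolding openin_quotient_topology by (rule conjunct1)
  have *: "{x \<in> topspace X. f x \<in> f ` topspace X} = topspace X" by auto
  have "openin (quotient_topology X f) (f ` topspace X)"
    unfolding openin_quotient_topology * by (intro conjI subset_refl openin_topspace)
  then show "f ` topspace X \<subseteq> topspace (quotient_topology X f)"
    by (rule openin_subset)
qed

text \<open>The topology of \<open>G Mod N\<close>, for \<open>N\<close> normal; the carrier consists of the cosets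
  \<open>N #> x\<close>.\<close>

definition Mod_topology ::
    "('a, 'b) monoid_scheme \<Rightarrow> 'a topology \<Rightarrow> 'a set \<Rightarrow> 'a set topology" where
  "Mod_topology G T N = quotient_topology T (\<lambda>x. N #>\<^bsub>G\<^esub> x)"

definition Hausdorff_quotients_contract :: "('a, 'b) monoid_scheme \<Rightarrow> 'a topology \<Rightarrow> bool" where
  "Hausdorff_quotients_contract G T \<longleftrightarrow>
     (\<forall>N. N \<lhd> G \<and> Hausdorff_space (Mod_topology G T N) \<and>
          carrier (G Mod N) \<noteq> {\<one>\<^bsub>G Mod N\<^esub>} \<longrightarrow>
        (\<exists>g\<in>carrier (G Mod N).
           contraction_group (G Mod N) (Mod_topology G T N) g \<noteq> {\<one>\<^bsub>G Mod N\<^esub>}))"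

text \<open>The homogeneous space \<open>G/H\<close> of left cosets \<open>x <# H\<close>. An element \<open>g\<close> acts on it by
  \<open>C \<mapsto> g <# C\<close>, which is left translation \<open>xH \<mapsto> gxH\<close>.\<close>

definition lcoset_topology ::
    "('a, 'b) monoid_scheme \<Rightarrow> 'a topology \<Rightarrow> 'a set \<Rightarrow> 'a set topology" where
  "lcoset_topology G T H = quotient_topology T (\<lambda>x. x <#\<^bsub>G\<^esub> H)"

lemma (in topological_group) topspace_lcoset_topology:
  "topspace (lcoset_topology G T H) = lcosets H"
  by (auto simp: lcoset_topology_def topspace_quotient_topology topspace_eq LCOSETS_def)

lemma (in topological_group) topspace_Mod_topology:
  "topspace (Mod_topology G T N) = carrier (G Mod N)"
  by (auto simp: Mod_topology_def topspace_quotient_topology topspace_eq FactGroup_def RCOSETS_def)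


section \<open>Invariant probability measures and ergodicity\<close>

text \<open>As usual on locally compact Hausdorff spaces, Borel probability measures are Radon, i.e.
  inner regular with respect to compact sets (for finite measures this is equivalent to the
  other common formulations). On \<open>G/H\<close> with \<open>G\<close> second countable this is automatic. For larger
  \<open>G\<close> it is what makes the \<open>G\<close>-invariant probability measure on \<open>G/H\<close> unique: if a
  real-valued measurable cardinal exists, an open subgroup of infinite index can have
  non-regular invariant measures, defined on all subsets of the discrete space \<open>G/H\<close>.\<close>

definition Radon_prob :: "'a topology \<Rightarrow> 'a measure \<Rightarrow> bool" where
  "Radon_prob X M \<longleftrightarrow>
     space M = topspace X \<and> sets M = sigma_sets (topspace X) {U. openin X U} \<and>
     prob_space M \<and>
     (\<forall>A\<in>sets M. emeasure M A = (SUP K\<in>{K. compactin X K \<and> K \<subseteq> A}. emeasure M K))"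

definition invariant_prob ::
    "('a, 'b) monoid_scheme \<Rightarrow> 'a topology \<Rightarrow> 'a set \<Rightarrow> 'a set measure \<Rightarrow> bool" where
  "invariant_prob G T H M \<longleftrightarrow>
     Radon_prob (lcoset_topology G T H) M \<and>
     (\<forall>g\<in>carrier G. distr M M (\<lambda>C. g <#\<^bsub>G\<^esub> C) = M)"

definition finite_covolume :: "('a, 'b) monoid_scheme \<Rightarrow> 'a topology \<Rightarrow> 'a set \<Rightarrow> bool" where
  "finite_covolume G T H \<longleftrightarrow> (\<exists>M. invariant_prob G T H M)"

text \<open>Invariance of \<open>A\<close> is only required up to null sets, separately for each \<open>s\<close>, as for
  invariant elements of \<open>L\<^sup>\<infinity>(M)\<close>. In particular, all strictly invariant measurable sets are
  null or conull.\<close>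

definition acts_ergodically :: "'s set \<Rightarrow> ('s \<Rightarrow> 'x \<Rightarrow> 'x) \<Rightarrow> 'x measure \<Rightarrow> bool" where
  "acts_ergodically S act M \<longleftrightarrow>
     (\<forall>A\<in>sets M. (\<forall>s\<in>S. sym_diff (act s ` A) A \<in> null_sets M) \<longrightarrow>
        A \<in> null_sets M \<or> space M - A \<in> null_sets M)"

end

theory Submission
  imports Defs
begin

text \<open>
  Quotients: let \<open>N\<close> be the closure of the Tits core, and let \<open>\<alpha>\<close> be conjugation by \<open>g\<close>. It suffices
  that \<open>con(gN)\<close> in \<open>G/N\<close> is the image of \<open>con(g)\<close>, since the latter lies in \<open>N\<close>. A point contracted
  modulo \<open>N\<close> gives a sequence \<open>u\<^sub>n \<rightarrow> 1\<close> with \<open>\<alpha>\<^sup>n(x) \<in> u\<^sub>nN\<close>, that is, a pseudo-orbit of \<open>\<alpha>\<close> with errors in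
  \<open>N\<close> tending to \<open>1\<close>. By compactness \<open>N\<close> has arbitrarily small relatively open compact subgroups
  \<open>V = V\<^sub>-V\<^sub>+\<close> with \<open>\<alpha>(V\<^sub>-) \<subseteq> V\<^sub>-\<close> and \<open>\<alpha>(V\<^sub>+) \<supseteq> V\<^sub>+\<close>. For such \<open>V\<close>, every pseudo-orbit with errors in \<open>V\<close> is
  shadowed by a true orbit up to \<open>V\<close>. Two solutions for the same \<open>V\<close> differ by an element of the compact
  \<open>\<alpha>\<close>-invariant group \<open>\<Inter>i. \<alpha>\<^sup>i(V)\<close>, up to an element whose orbit eventually stays in a given
  smaller subgroup; so along a decreasing base of such \<open>V\<close> the solutions can be corrected to converge.

  Ergodicity: let \<open>A \<subseteq> G/H\<close> be invariant under \<open>H\<close> modulo null sets. The function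
  \<open>d(g) = \<mu>(gA \<triangle> A)\<close> is symmetric, subadditive, continuous at \<open>1\<close>, and vanishes on \<open>H\<close>. Poincare
  recurrence on \<open>G/H\<close> gives \<open>d(g\<^sup>n) < \<epsilon>\<close> for arbitrarily large \<open>n\<close>. If \<open>x \<in> con(g)\<close>, then
  \<open>d(x) \<le> 2d(g\<^sup>n) + d(g\<^sup>nxg\<^sup>-\<^sup>n)\<close>, hence \<open>d(x) = 0\<close>. So \<open>d\<close> vanishes on the closed subgroup generated by all
  contraction groups, which is \<open>G\<close>. Finally, a set invariant under all of \<open>G\<close> has the same density in
  every orbit of every compact open subgroup, and by regularity this density is \<open>0\<close> or \<open>1\<close>.
\<close>

no_notation subset_mset (infix \<open><#\<close> 50)

section \<open>Topological groups\<close>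

text \<open>Compactness is asked of \<open>C 0\<close> only: all later sets are closed subsets of
  that compact subspace. The passages from finite stages to a limit in the shadowing arguments go
  through this lemma.\<close>

lemma compactin_nest:
  fixes C :: "nat \<Rightarrow> 'a set"
  assumes "compactin X (C 0)" "\<And>n. closedin X (C n)" "\<And>n. C n \<noteq> {}" "\<And>n. C (Suc n) \<subseteq> C n"
  shows "(\<Inter>n. C n) \<noteq> {}"
proof (rule compact_space_imp_nest)
  show dec: "decseq C"
    using assms(4) by (rule decseq_SucI)
  show "compact_space (subtopology X (C 0))"
    using assms(1) by (rule compact_space_subtopology)
  show "closedin (subtopology X (C 0)) (C n)" for n
    using assms(2) dec by (auto simp: closedin_subset_topspace decseq_def)
qed (use assms in auto)

section \<open>Translations, cosets and open subgroups\<close>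

context topological_group
begin

lemma openin_subset_carrier: "openin T U \<Longrightarrow> U \<subseteq> carrier G"
  using openin_subset topspace_eq by auto

lemma compactin_subset_carrier: "compactin T U \<Longrightarrow> U \<subseteq> carrier G"
  using compactin_subset_topspace topspace_eq by auto

lemma compactin_closedin: "compactin T K \<Longrightarrow> closedin T K"
  using Hausdorff by (rule compactin_imp_closedin)

lemma openin_carrier: "openin T (carrier G)"
  using openin_topspace[of T] topspace_eq by simp

lemma continuous_map_multI:
  assumes "continuous_map X T f" "continuous_map X T g"
  shows "continuous_map X T (\<lambda>x. f x \<otimes> g x)"
proof -
  have "continuous_map X (prod_topology T T) (\<lambda>x. (f x, g x))"
    using assms by (simp add: continuous_map_pairedI)
  then have "continuous_map X T ((\<lambda>(x, y). x \<otimes> y) \<circ> (\<lambda>x. (f x, g x)))"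
    using continuous_mult by (rule continuous_map_compose)
  then show ?thesis by (simp add: o_def)
qed

lemma continuous_map_invI:
  assumes "continuous_map X T f"
  shows "continuous_map X T (\<lambda>x. inv f x)"
  using continuous_map_compose[OF assms continuous_inv] by (simp add: o_def)

lemma continuous_map_constI: "c \<in> carrier G \<Longrightarrow> continuous_map X T (\<lambda>x. c)"
  by (simp add: topspace_eq)

lemmas group_continuous_intros =
  continuous_map_multI continuous_map_invI continuous_map_constI continuous_map_id[unfolded id_def]

lemma openin_preimage: "continuous_map T T f \<Longrightarrow> openin T U \<Longrightarrow> openin T {x \<in> carrier G. f x \<in> U}"
  using openin_continuous_map_preimage[of T T f U] by (simp add: topspace_eq)

lemma closedin_preimage: "continuous_map T T f \<Longrightarrow> closedin T U \<Longrightarrow> closedin T {x \<in> carrier G. f x \<in> U}"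
  using closedin_continuous_map_preimage[of T T f U] by (simp add: topspace_eq)

lemma continuous_translate: "c \<in> carrier G \<Longrightarrow> continuous_map T T (\<lambda>x. c \<otimes> x)"
  by (intro group_continuous_intros)

lemma inv_mult_cancel:
  assumes "x \<in> carrier G" "y \<in> carrier G"
  shows "x \<otimes> (inv x \<otimes> y) = y" "inv x \<otimes> (x \<otimes> y) = y"
  using assms by (simp_all add: m_assoc[symmetric])

lemma mem_l_coset_iff:
  "c \<in> carrier G \<Longrightarrow> S \<subseteq> carrier G \<Longrightarrow> x \<in> c <# S \<longleftrightarrow> x \<in> carrier G \<and> inv c \<otimes> x \<in> S"
  by (auto simp: l_coset_def m_assoc[symmetric] intro!: bexI[of _ "inv c \<otimes> x"])

lemma mem_r_coset_iff:
  "c \<in> carrier G \<Longrightarrow> S \<subseteq> carrier G \<Longrightarrow> x \<in> S #> c \<longleftrightarrow> x \<in> carrier G \<and> x \<otimes> inv c \<in> S"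
  by (auto simp: r_coset_def m_assoc intro!: bexI[of _ "x \<otimes> inv c"])

lemma openin_l_coset: "c \<in> carrier G \<Longrightarrow> openin T U \<Longrightarrow> openin T (c <# U)"
  using openin_preimage[of "\<lambda>x. inv c \<otimes> x" U] continuous_translate[of "inv c"]
    openin_subset_carrier[of U]
  by (simp add: mem_l_coset_iff set_eq_iff[of "{x \<in> carrier G. inv c \<otimes> x \<in> U}" "c <# U", THEN iffD2])

lemma openin_r_coset:
  assumes "c \<in> carrier G" "openin T U" shows "openin T (U #> c)"
proof -
  have "continuous_map T T (\<lambda>x. x \<otimes> inv c)"
    using assms by (intro group_continuous_intros) auto
  moreover have "U #> c = {x \<in> carrier G. x \<otimes> inv c \<in> U}"
    using assms openin_subset_carrier by (auto simp: mem_r_coset_iff)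
  ultimately show ?thesis using assms openin_preimage by simp
qed

lemma compactin_l_coset: "c \<in> carrier G \<Longrightarrow> compactin T U \<Longrightarrow> compactin T (c <# U)"
  using image_compactin[of T U T "\<lambda>x. c \<otimes> x"] continuous_translate[of c]
  by (simp add: l_coset_def UNION_singleton_eq_range)

lemma subgroup_mult_cancel_left:
  assumes "subgroup V G" "x \<in> V" "y \<in> carrier G"
  shows "x \<otimes> y \<in> V \<longleftrightarrow> y \<in> V"
proof
  interpret V: subgroup V G by fact
  assume "x \<otimes> y \<in> V"
  then have "inv x \<otimes> (x \<otimes> y) \<in> V" using assms V.m_inv_closed by blast
  then show "y \<in> V" using assms V.mem_carrier by (simp add: m_assoc[symmetric])
qed (use assms subgroup.m_closed in fast)

lemma subgroup_mult_cancel_right: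
  assumes "subgroup V G" "x \<in> V" "y \<in> carrier G"
  shows "y \<otimes> x \<in> V \<longleftrightarrow> y \<in> V"
proof
  interpret V: subgroup V G by fact
  assume "y \<otimes> x \<in> V"
  then have "(y \<otimes> x) \<otimes> inv x \<in> V" using assms V.m_inv_closed by blast
  then show "y \<in> V" using assms V.mem_carrier by (simp add: m_assoc)
qed (use assms subgroup.m_closed in fast)

lemma subgroup_l_coset_eq_iff:
  assumes "subgroup V G" "x \<in> carrier G" "y \<in> carrier G"
  shows "x <# V = y <# V \<longleftrightarrow> inv x \<otimes> y \<in> V"
proof
  interpret V: subgroup V G by fact
  have V: "V \<subseteq> carrier G" by (rule V.subset)
  assume "x <# V = y <# V"
  moreover have "y \<in> y <# V" using assms by (simp add: mem_l_coset_iff[OF _ V])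
  ultimately show "inv x \<otimes> y \<in> V" using assms by (metis mem_l_coset_iff[OF _ V])
next
  interpret V: subgroup V G by fact
  have V: "V \<subseteq> carrier G" by (rule V.subset)
  assume *: "inv x \<otimes> y \<in> V"
  have "inv x \<otimes> z \<in> V \<longleftrightarrow> inv y \<otimes> z \<in> V" if z: "z \<in> carrier G" for z
  proof -
    have "inv x \<otimes> z = (inv x \<otimes> y) \<otimes> (inv y \<otimes> z)"
      using assms z by (simp add: m_assoc inv_mult_cancel)
    then show ?thesis
      using subgroup_mult_cancel_left[OF assms(1) *, of "inv y \<otimes> z"] assms z by simp
  qed
  then show "x <# V = y <# V" using assms V by (auto simp: mem_l_coset_iff)
qed

text \<open>Continuity in one variable at a time suffices: products are first treated with the left
  factor in \<open>S\<close>, and then, for a fixed right factor in the closure, the left factor is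
  moved to the closure as well.\<close>

lemma closure_of_subgroup:
  assumes "subgroup S G" shows "subgroup (T closure_of S) G"
proof -
  interpret S: subgroup S G by fact
  let ?C = "T closure_of S"
  have sub: "S \<subseteq> ?C" using S.subset by (simp add: closure_of_subset topspace_eq)
  have C: "?C \<subseteq> carrier G" using closure_of_subset_topspace topspace_eq by metis
  have step: "f ` ?C \<subseteq> ?C" if "continuous_map T T f" "f ` S \<subseteq> ?C" for f
  proof -
    have "f ` ?C \<subseteq> T closure_of (f ` S)"
      using that by (simp add: continuous_map_image_closure_subset)
    also have "\<dots> \<subseteq> ?C" using that(2) by (simp add: closure_of_minimal)
    finally show ?thesis .
  qed
  have 1: "x \<otimes> y \<in> ?C" if "x \<in> S" "y \<in> ?C" for x y
  proof -
    have "(\<lambda>y. x \<otimes> y) ` ?C \<subseteq> ?C"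
      using that sub by (intro step group_continuous_intros) (auto intro: S.m_closed)
    then show ?thesis using that by auto
  qed
  have 2: "x \<otimes> y \<in> ?C" if "x \<in> ?C" "y \<in> ?C" for x y
  proof -
    have "(\<lambda>x. x \<otimes> y) ` ?C \<subseteq> ?C"
      using that C by (intro step group_continuous_intros) (auto intro: 1)
    then show ?thesis using that by auto
  qed
  have 3: "inv x \<in> ?C" if "x \<in> ?C" for x
  proof -
    have "(\<lambda>x. inv x) ` ?C \<subseteq> ?C"
      using that C sub by (intro step group_continuous_intros) (auto intro: S.m_inv_closed)
    then show ?thesis using that by auto
  qed
  show ?thesis
    using C 2 3 sub S.one_closed by (intro subgroupI) blast+
qed

lemma subgroup_openin:
  assumes "subgroup S G" "openin T W" "\<one> \<in> W" "W \<subseteq> S" shows "openin T S"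
proof -
  interpret S: subgroup S G by fact
  have "\<exists>U. openin T U \<and> x \<in> U \<and> U \<subseteq> S" if x: "x \<in> S" for x
  proof (intro exI conjI)
    have W: "W \<subseteq> carrier G" using assms(2) openin_subset_carrier by auto
    show "openin T (x <# W)" using x assms by (intro openin_l_coset) auto
    show "x \<in> x <# W" using x W assms(3) by (simp add: mem_l_coset_iff)
    show "x <# W \<subseteq> S" using x assms(4) by (auto simp: l_coset_def intro: S.m_closed)
  qed
  then show ?thesis by (subst openin_subopen) blast
qed

text \<open>The complement is a union of left cosets, which are open.\<close>

lemma open_subgroup_closedin:
  assumes "subgroup S G" "openin T S" shows "closedin T S"
proof -
  interpret S: subgroup S G by fact
  have "\<exists>U. openin T U \<and> x \<in> U \<and> U \<subseteq> carrier G - S" if x: "x \<in> carrier G - S" for x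
  proof (intro exI conjI)
    show "openin T (x <# S)" using x assms by (intro openin_l_coset) auto
    show "x \<in> x <# S" using x S.subset by (simp add: mem_l_coset_iff)
    show "x <# S \<subseteq> carrier G - S"
      using x subgroup_mult_cancel_right[OF assms(1)] by (auto simp: l_coset_def)
  qed
  then have "openin T (carrier G - S)" by (subst openin_subopen) blast
  then show ?thesis using S.subset by (simp add: closedin_def topspace_eq)
qed

lemma nbhd_mult:
  assumes "openin T U" "x \<in> carrier G" "y \<in> carrier G" "x \<otimes> y \<in> U"
  obtains A B where "openin T A" "openin T B" "x \<in> A" "y \<in> B" "\<And>a b. a \<in> A \<Longrightarrow> b \<in> B \<Longrightarrow> a \<otimes> b \<in> U"
proof -
  define P where "P = {z \<in> topspace (prod_topology T T). (\<lambda>(x, y). x \<otimes> y) z \<in> U}"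
  have "openin (prod_topology T T) P"
    unfolding P_def using continuous_mult assms(1) by (rule openin_continuous_map_preimage)
  moreover have "(x, y) \<in> P"
    using assms by (simp add: topspace_eq P_def)
  ultimately obtain A B where "openin T A" "openin T B" "x \<in> A" "y \<in> B" and AB: "A \<times> B \<subseteq> P"
    unfolding openin_prod_topology_alt by meson
  moreover have "a \<otimes> b \<in> U" if "a \<in> A" "b \<in> B" for a b
    using subsetD[OF AB, of "(a, b)"] that by (simp add: P_def)
  ultimately show ?thesis using that by simp
qed

text \<open>The cosets meeting \<open>C\<close> form an open cover of it by pairwise disjoint sets,
  so a finite subcover must contain each of them.\<close>

lemma finite_l_cosets_compactin:
  assumes "compactin T C" "subgroup S G" "openin T S"
  shows "finite ((\<lambda>x. x <# S) ` C)"
proof -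
  interpret S: subgroup S G by fact
  have C: "C \<subseteq> carrier G" using assms(1) by (rule compactin_subset_carrier)
  have "\<And>U. U \<in> (\<lambda>x. x <# S) ` C \<Longrightarrow> openin T U"
    using assms C openin_l_coset by auto
  moreover have "C \<subseteq> \<Union> ((\<lambda>x. x <# S) ` C)"
    using C by (auto intro!: lcos_self assms)
  ultimately obtain F where F: "finite F" "F \<subseteq> (\<lambda>x. x <# S) ` C" "C \<subseteq> \<Union>F"
    using compactinD[OF assms(1), of "(\<lambda>x. x <# S) ` C"] by blast
  have "x <# S \<in> F" if x: "x \<in> C" for x
  proof -
    obtain y where y: "y \<in> C" "y <# S \<in> F" "x \<in> y <# S" using F x by fastforce
    then have "y <# S = x <# S"
      using C x S.subset subgroup_l_coset_eq_iff[OF assms(2), of y x] mem_l_coset_iff[of y S x] by auto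
    then show ?thesis using y by simp
  qed
  then have "(\<lambda>x. x <# S) ` C \<subseteq> F" by (rule image_subsetI)
  then show ?thesis using F(1) by (rule finite_subset)
qed

end

text \<open>The stabiliser of a compact open set containing \<open>\<one>\<close>, under right translation, is a compact
  open subgroup contained in it.\<close>

lemma (in tdlc_group) compact_open_subgroup_base:
  assumes "openin T U" "\<one> \<in> U"
  obtains S where "subgroup S G" "openin T S" "compactin T S" "S \<subseteq> U"
proof -
  obtain W0 K0 where K0: "openin T W0" "compactin T K0" "\<one> \<in> W0" "W0 \<subseteq> K0"
    using locally_compact topspace_eq unfolding locally_compact_space_def by (metis one_closed)
  have "connected_component_of_set T \<one> = {\<one>}"
  proof -
    obtain a where "connected_component_of_set T \<one> \<subseteq> {a}"
      using totally_disconnected connectedin_connected_component_of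
      unfolding totally_disconnected_space_def by metis
    moreover have "\<one> \<in> connected_component_of_set T \<one>"
      by (simp add: connected_component_of_refl topspace_eq)
    ultimately show ?thesis by auto
  qed
  then have comp: "{\<one>} \<in> connected_components_of T"
    unfolding connected_components_of_def using topspace_eq by force
  \<comment> \<open>The component \<open>{\<one>}\<close> is compact, so in a locally compact
    Hausdorff space it has arbitrarily small clopen neighbourhoods; inside \<open>K0\<close> such a
    neighbourhood is compact.\<close>
  obtain K K' where K: "openin T K" "openin T K'" "disjnt K K'" "K \<union> K' = topspace T"
      "{\<one>} \<subseteq> K" "K \<subseteq> U \<inter> W0"
    by (rule wilder_locally_compact_component_thm[OF locally_compact Hausdorff comp, of "U \<inter> W0"])
      (use assms K0 topspace_eq in auto)
  have "K = topspace T - K'" using K(3,4) by (auto simp: disjnt_def)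
  then have "closedin T K" using K(2) by auto
  then have cK: "compactin T K" using closed_compactin[OF K0(2)] K(6) K0(4) by blast
  have KG: "K \<subseteq> carrier G" using K(1) openin_subset_carrier by auto
  \<comment> \<open>Tube argument: finitely many of the sets \<open>A x\<close> cover
    \<open>K\<close>, and the intersection \<open>W\<close> of the matching \<open>B x\<close>
    satisfies \<open>K W \<subseteq> K\<close>.\<close>
  have "\<exists>A B. x \<in> A \<and> \<one> \<in> B \<and> openin T A \<and> openin T B \<and> (\<forall>a\<in>A. \<forall>b\<in>B. a \<otimes> b \<in> K)" if x: "x \<in> K" for x
  proof -
    have "x \<in> carrier G" "x \<otimes> \<one> \<in> K" using x KG by auto
    then obtain A B where "openin T A" "openin T B" "x \<in> A" "\<one> \<in> B"
      "\<And>a b. a \<in> A \<Longrightarrow> b \<in> B \<Longrightarrow> a \<otimes> b \<in> K"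
      using nbhd_mult[OF K(1), of x \<one>] by blast
    then show ?thesis by blast
  qed
  then obtain A B where AB: "\<And>x. x \<in> K \<Longrightarrow> x \<in> A x \<and> \<one> \<in> B x \<and> openin T (A x) \<and> openin T (B x) \<and>
      (\<forall>a\<in>A x. \<forall>b\<in>B x. a \<otimes> b \<in> K)"
    by metis
  obtain F where F: "finite F" "F \<subseteq> A ` K" "K \<subseteq> \<Union>F"
    using compactinD[OF cK, of "A ` K"] AB by blast
  obtain E where E: "finite E" "E \<subseteq> K" "F = A ` E"
    using F finite_subset_image by metis
  define W where "W = carrier G \<inter> (\<Inter>x\<in>E. B x)"
  have "openin T W"
  proof (cases "E = {}")
    case False
    have "openin T (\<Inter>x\<in>E. B x)" using E AB False by (intro openin_INT2) auto
    then show ?thesis using W_def openin_carrier by auto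
  qed (use W_def openin_carrier in auto)
  have "\<one> \<in> W" using E AB by (auto simp: W_def)
  have KW: "k \<otimes> w \<in> K" if kw: "k \<in> K" "w \<in> W" for k w
  proof -
    obtain x where "x \<in> E" "k \<in> A x" using F(3) E(3) kw(1) by blast
    then show ?thesis using AB[of x] E kw by (auto simp: W_def)
  qed
  \<comment> \<open>The equivalence encodes \<open>K x = K\<close> instead of an inclusion, which
    makes \<open>S\<close> closed under inverses.\<close>
  define S where "S = {x \<in> carrier G. \<forall>k\<in>carrier G. k \<otimes> x \<in> K \<longleftrightarrow> k \<in> K}"
  have S: "subgroup S G"
  proof (rule subgroupI)
    show "S \<subseteq> carrier G" by (auto simp: S_def)
    show "S \<noteq> {}" by (auto simp: S_def intro!: exI[of _ \<one>])
    show "inv x \<in> S" if "x \<in> S" for x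
    proof -
      have x: "x \<in> carrier G" using that by (simp add: S_def)
      have "k \<otimes> inv x \<in> K \<longleftrightarrow> k \<in> K" if k: "k \<in> carrier G" for k
      proof -
        have "(k \<otimes> inv x) \<otimes> x \<in> K \<longleftrightarrow> k \<otimes> inv x \<in> K"
          using \<open>x \<in> S\<close> x k by (simp add: S_def)
        then show ?thesis using x k by (simp add: m_assoc)
      qed
      then show ?thesis using x by (simp add: S_def)
    qed
    show "x \<otimes> y \<in> S" if "x \<in> S" "y \<in> S" for x y
      using that by (simp add: S_def m_assoc[symmetric])
  qed
  \<comment> \<open>Both directions of the equivalence are needed: \<open>w \<in> W\<close> gives
    one, \<open>inv w \<in> W\<close> the other.\<close>
  define W' where "W' = W \<inter> {x \<in> carrier G. inv x \<in> W}"
  have "openin T W'"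
    unfolding W'_def using \<open>openin T W\<close> openin_preimage[OF continuous_inv] by blast
  have "W' \<subseteq> S"
  proof
    fix w assume w: "w \<in> W'"
    then have wc: "w \<in> carrier G" "w \<in> W" "inv w \<in> W" by (simp_all add: W'_def)
    have "k \<in> K" if "k \<in> carrier G" "k \<otimes> w \<in> K" for k
      using KW[OF that(2) wc(3)] that wc by (simp add: m_assoc)
    then show "w \<in> S" using wc(1) KW[OF _ wc(2)] unfolding S_def by blast
  qed
  have "openin T S"
    by (rule subgroup_openin[OF S \<open>openin T W'\<close> _ \<open>W' \<subseteq> S\<close>]) (use \<open>\<one> \<in> W\<close> in \<open>simp add: W'_def\<close>)
  have "S \<subseteq> K"
  proof
    fix x assume "x \<in> S"
    then have "x \<in> carrier G" "\<forall>k\<in>carrier G. k \<otimes> x \<in> K \<longleftrightarrow> k \<in> K"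
      by (simp_all add: S_def)
    from bspec[OF this(2) one_closed] this(1) K(5) show "x \<in> K" by simp
  qed
  have "compactin T S"
    using cK \<open>S \<subseteq> K\<close> open_subgroup_closedin[OF S \<open>openin T S\<close>] by (rule closed_compactin)
  moreover have "S \<subseteq> U" using \<open>S \<subseteq> K\<close> K(6) by blast
  ultimately show ?thesis using that S \<open>openin T S\<close> by simp
qed

section \<open>Shadowing for automorphisms\<close>

text \<open>An action of the integers by continuous homomorphisms; each \<open>a i\<close> has the
  inverse \<open>a (- i)\<close>. Taking the whole action as the parameter turns backward iteration
  into integer arithmetic.\<close>

locale automorphism_flow = topological_group +
  fixes a :: "int \<Rightarrow> 'a \<Rightarrow> 'a"
  assumes flow_zero: "x \<in> carrier G \<Longrightarrow> a 0 x = x"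
    and flow_add: "x \<in> carrier G \<Longrightarrow> a (i + j) x = a i (a j x)"
    and flow_mult: "x \<in> carrier G \<Longrightarrow> y \<in> carrier G \<Longrightarrow> a i (x \<otimes> y) = a i x \<otimes> a i y"
    and flow_continuous: "continuous_map T T (a i)"
begin

lemma flow_closed [simp]: "x \<in> carrier G \<Longrightarrow> a i x \<in> carrier G"
  using continuous_map_image_subset_topspace[OF flow_continuous[of i]] topspace_eq by auto

lemma flow_one [simp]: "a i \<one> = \<one>"
  using flow_mult[of \<one> \<one> i] l_cancel_one'[of "a i \<one>" "a i \<one>"] by simp

lemma flow_inv: "x \<in> carrier G \<Longrightarrow> a i (inv x) = inv (a i x)"
  using flow_mult[of "inv x" x i] inv_equality[of "a i (inv x)" "a i x"] by simp

lemma flow_flow: "x \<in> carrier G \<Longrightarrow> a i (a j x) = a (i + j) x"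
  by (simp add: flow_add)

text \<open>This is the intersection of the sets \<open>\<alpha>^(-j)(U)\<close> over
  \<open>j \<in> J\<close>. Finite intervals \<open>J\<close> give the approximations in the tidying
  procedure, half-lines give the forward and backward parts, and \<open>UNIV\<close> gives the
  largest invariant subset of \<open>U\<close>.\<close>

definition window :: "int set \<Rightarrow> 'a set \<Rightarrow> 'a set" where
  "window J U = {x \<in> carrier G. \<forall>j\<in>J. a j x \<in> U}"

lemma window_subset_carrier: "window J U \<subseteq> carrier G"
  by (auto simp: window_def)

lemma window_mono: "J' \<subseteq> J \<Longrightarrow> U \<subseteq> U' \<Longrightarrow> window J U \<subseteq> window J' U'"
  by (auto simp: window_def)

lemma window_subset: "0 \<in> J \<Longrightarrow> window J U \<subseteq> U"
  by (auto simp: window_def flow_zero dest: bspec[of _ _ 0])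

lemma subgroup_window: "subgroup U G \<Longrightarrow> subgroup (window J U) G"
  by (rule subgroupI)
    (auto simp: window_def flow_mult flow_inv intro!: exI[of _ \<one>]
      intro: subgroup.m_closed subgroup.m_inv_closed subgroup.one_closed)

lemma closedin_window:
  assumes "closedin T U" shows "closedin T (window J U)"
proof -
  have "window J U = \<Inter> (insert (carrier G) ((\<lambda>j. {x \<in> carrier G. a j x \<in> U}) ` J))"
    by (auto simp: window_def)
  moreover have "closedin T (\<Inter> (insert (carrier G) ((\<lambda>j. {x \<in> carrier G. a j x \<in> U}) ` J)))"
    using assms closedin_preimage[OF flow_continuous] closedin_topspace[of T]
    by (intro closedin_Inter) (auto simp: topspace_eq)
  ultimately show ?thesis by simp
qed

lemma openin_window:
  assumes "openin T U" "finite J" shows "openin T (window J U)"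
proof -
  have "window J U = \<Inter> (insert (carrier G) ((\<lambda>j. {x \<in> carrier G. a j x \<in> U}) ` J))"
    by (auto simp: window_def)
  moreover have "openin T (\<Inter> (insert (carrier G) ((\<lambda>j. {x \<in> carrier G. a j x \<in> U}) ` J)))"
    using assms openin_preimage[OF flow_continuous] openin_carrier
    by (intro openin_Inter) auto
  ultimately show ?thesis by simp
qed

text \<open>Since negative \<open>i\<close> are included, each \<open>a i\<close> maps
  \<open>P\<close> onto \<open>P\<close>.\<close>

definition flow_invariant :: "'a set \<Rightarrow> bool" where
  "flow_invariant P \<longleftrightarrow> subgroup P G \<and> closedin T P \<and> (\<forall>i. \<forall>x\<in>P. a i x \<in> P)"

text \<open>In the usual notation for the automorphism \<open>\<alpha> = a 1\<close>, \<open>window {0..} V\<close> is \<open>V\<^sub>-\<close> and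
  \<open>window {..0} V\<close> is \<open>V\<^sub>+\<close>.\<close>

definition tidy_above :: "'a set \<Rightarrow> 'a set \<Rightarrow> bool" where
  "tidy_above P V \<longleftrightarrow> subgroup V G \<and> compactin T V \<and> V \<subseteq> P \<and>
     (\<exists>W. openin T W \<and> \<one> \<in> W \<and> W \<inter> P \<subseteq> V) \<and>
     (\<forall>v\<in>V. \<exists>b\<in>window {0..} V. \<exists>c\<in>window {..0} V. v = b \<otimes> c)"

text \<open>Let \<open>U = P \<inter> S\<close> and \<open>U\<^sub>n = \<Inter>i\<le>n. \<alpha>\<^sup>i(U)\<close>. The finite sets of cosets of \<open>S\<close> met by \<open>\<alpha>(U\<^sub>n)\<close>
  decrease with \<open>n\<close>, and \<open>U\<^sub>n\<close> is tidy above as soon as they are constant.\<close>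

lemma tidy_above_exists:
  assumes P: "flow_invariant P" and S: "subgroup S G" "openin T S" "compactin T S"
  shows "\<exists>V. tidy_above P V \<and> V \<subseteq> S"
proof -
  have PG: "subgroup P G" "closedin T P" and Pa: "\<And>i x. x \<in> P \<Longrightarrow> a i x \<in> P"
    using P unfolding flow_invariant_def by auto
  define U where "U = P \<inter> S"
  have U: "subgroup U G" unfolding U_def using PG(1) S(1) by (rule subgroups_Inter_pair)
  interpret U: subgroup U G by fact
  have cU: "compactin T U" unfolding U_def using PG(2) S(3) by (rule closed_Int_compactin)
  then have clU: "closedin T U" by (rule compactin_closedin)
  have UI: "x \<in> U \<longleftrightarrow> x \<in> S" if "x \<in> P" for x using that U_def by auto
  \<comment> \<open>\<open>E m\<close> is \<open>\<alpha>(U\<^sub>m)\<close>, because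
    \<open>U\<^sub>m\<close> is \<open>window {- int m..0} U\<close>.\<close>
  define E where "E m = window {- int m - 1..-1} U" for m
  have E_sub: "E m \<subseteq> carrier G" for m by (simp add: E_def window_subset_carrier)
  have E_dec: "E m \<subseteq> E n" if "n \<le> m" for m n
    unfolding E_def using that by (intro window_mono) auto
  have E_im: "E m \<subseteq> a 1 ` U" for m
  proof
    fix x assume "x \<in> E m"
    then have "x \<in> carrier G" "a (-1) x \<in> U" by (auto simp: E_def window_def)
    moreover from this have "x = a 1 (a (-1) x)" by (simp add: flow_flow flow_zero)
    ultimately show "x \<in> a 1 ` U" by blast
  qed
  have cE: "compactin T (E m)" for m
    using image_compactin[OF cU flow_continuous] E_im[of m]
    by (rule closed_compactin) (simp add: E_def closedin_window clU)
  define Q where "Q m = (\<lambda>x. x <# S) ` E m" for m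
  have finQ: "finite (Q m)" for m
    unfolding Q_def using cE S(1,2) by (rule finite_l_cosets_compactin)
  \<comment> \<open>The finite sets \<open>Q m\<close> decrease, so from an index of minimal
    cardinality on they are constant.\<close>
  obtain n where n: "\<And>m. card (Q n) \<le> card (Q m)"
    using ex_has_least_nat[of "\<lambda>_. True" 0 "\<lambda>m. card (Q m)"] by auto
  have Q_eq: "Q m = Q n" if "n \<le> m" for m
  proof (rule card_subset_eq)
    show "Q m \<subseteq> Q n" unfolding Q_def using E_dec[OF that] by (rule image_mono)
    then show "card (Q m) = card (Q n)" using n[of m] card_mono[OF finQ, of "Q m" n] by simp
  qed (rule finQ)
  \<comment> \<open>The coset of \<open>x\<close> is met by every later \<open>E (n + m)\<close>. By
    compactness these sets have a common point in the coset, and its iterates at all times up to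
    \<open>-1\<close> lie in \<open>U\<close>.\<close>
  have step1: "\<exists>y\<in>window {..-1} U. inv x \<otimes> y \<in> S" if x: "x \<in> E n" for x
  proof -
    have xG: "x \<in> carrier G" using x E_sub by auto
    define C where "C m = E (n + m) \<inter> (x <# S)" for m
    have "(\<Inter>m. C m) \<noteq> {}"
    proof (rule compactin_nest)
      have cl: "closedin T (x <# S)" using xG S(3) by (intro compactin_closedin compactin_l_coset)
      then show "compactin T (C 0)" unfolding C_def using cE by (intro compact_Int_closedin)
      show "closedin T (C m)" for m
        unfolding C_def using cl clU by (intro closedin_Int) (auto simp: E_def intro: closedin_window)
      show "C (Suc m) \<subseteq> C m" for m unfolding C_def using E_dec[of "n + m" "n + Suc m"] by auto
      show "C m \<noteq> {}" for m
      proof -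
        have "x <# S \<in> Q (n + m)" using Q_eq[of "n + m"] x by (auto simp: Q_def)
        then obtain y where y: "y \<in> E (n + m)" "x <# S = y <# S" by (auto simp: Q_def)
        then have "y \<in> x <# S" using E_sub lcos_self[of y S] S(1) by auto
        then show ?thesis using y by (auto simp: C_def)
      qed
    qed
    then obtain y where y: "\<And>m. y \<in> C m" by blast
    have yG: "y \<in> carrier G" using y[of 0] E_sub by (auto simp: C_def)
    have "a j y \<in> U" if "j \<le> -1" for j
    proof -
      have "y \<in> E (n + nat (-j))" using y by (auto simp: C_def)
      then show ?thesis using that by (auto simp: E_def window_def)
    qed
    moreover have "inv x \<otimes> y \<in> S"
      using y[of 0] xG subgroup.subset[OF S(1)] by (auto simp: C_def mem_l_coset_iff)
    ultimately show ?thesis using yG by (auto simp: window_def)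
  qed
  \<comment> \<open>Pull the point that \<open>step1\<close> assigns to \<open>a 1 x\<close> back by
    one step. The result \<open>c\<close> has its whole backward orbit in \<open>U\<close>, and
    dividing by it makes \<open>x\<close> survive one more forward step. Only membership in
    \<open>S\<close> is at stake, as \<open>P\<close> is invariant.\<close>
  have step2: "\<exists>c\<in>window {..0} U. a 1 (inv c \<otimes> x) \<in> U" if x: "x \<in> window {- int n..0} U" for x
  proof -
    have xG: "x \<in> carrier G" using x window_subset_carrier by auto
    have xU: "x \<in> U" using x window_subset[of "{- int n..0}" U] by auto
    have "a 1 x \<in> E n" unfolding E_def using x xG by (auto simp: window_def flow_flow)
    then obtain y where y: "y \<in> window {..-1} U" "inv (a 1 x) \<otimes> y \<in> S" using step1 by blast
    then have yG: "y \<in> carrier G" using window_subset_carrier by auto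
    define c where "c = a (-1) y"
    have c: "c \<in> window {..0} U" unfolding c_def using y yG by (auto simp: window_def flow_flow)
    then have cU: "c \<in> U" using window_subset[of "{..0}" U] by auto
    then have cG: "c \<in> carrier G" by simp
    have "y = a 1 c" using yG by (simp add: c_def flow_flow flow_zero)
    then have "a 1 (inv x \<otimes> c) \<in> S" using y xG cG by (simp add: flow_mult flow_inv)
    moreover have "inv x \<otimes> c \<in> P"
      using U.m_closed[OF U.m_inv_closed[OF xU] cU] unfolding U_def by blast
    ultimately have "a 1 (inv x \<otimes> c) \<in> U" using UI Pa by blast
    then have "inv (a 1 (inv x \<otimes> c)) \<in> U" by simp
    then have "a 1 (inv c \<otimes> x) \<in> U" using xG cG by (simp add: flow_inv[symmetric] inv_mult_group)
    then show ?thesis using c by blast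
  qed
  \<comment> \<open>Induction on the number of forward steps: move the remainder forward by
    \<open>m\<close>, apply \<open>step2\<close>, and move the correction back by \<open>m\<close>.
    The correction then lies in \<open>U\<close> at all times up to \<open>m\<close>, so what was
    achieved before is kept.\<close>
  have step3: "\<exists>c\<in>window {..0} U. inv c \<otimes> v \<in> window {- int n..int m} U" if v: "v \<in> window {- int n..0} U" for v m
  proof (induction m)
    case 0
    have "\<one> \<in> window {..0} U" by (simp add: window_def)
    moreover have "v \<in> carrier G" using v window_subset_carrier by auto
    ultimately show ?case using v by (auto intro!: bexI[of _ \<one>])
  next
    case (Suc m)
    have vG: "v \<in> carrier G" using v window_subset_carrier by auto
    obtain c1 where c1: "c1 \<in> window {..0} U" "inv c1 \<otimes> v \<in> window {- int n..int m} U"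
      using Suc by blast
    have c1G: "c1 \<in> carrier G" using c1 window_subset_carrier by auto
    define x where "x = inv c1 \<otimes> v"
    have xG: "x \<in> carrier G" using c1G vG by (simp add: x_def)
    have xw: "x \<in> window {- int n..int m} U" using c1 x_def by simp
    have "a (int m) x \<in> window {- int n..0} U" using xw xG by (auto simp: window_def flow_flow)
    then obtain c0 where c0: "c0 \<in> window {..0} U" "a 1 (inv c0 \<otimes> a (int m) x) \<in> U"
      using step2 by blast
    have c0G: "c0 \<in> carrier G" using c0 window_subset_carrier by auto
    define c where "c = a (- int m) c0"
    have cG: "c \<in> carrier G" using c0G by (simp add: c_def)
    have cj: "a j c \<in> U" if "j \<le> int m" for j
      using c0 c0G that by (auto simp: c_def window_def flow_flow)
    have "c0 = a (int m) c" using c0G by (simp add: c_def flow_flow flow_zero)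
    then have last: "a (int (Suc m)) (inv c \<otimes> x) \<in> U"
      using c0(2) cG xG by (simp add: flow_inv flow_mult flow_flow add.commute)
    have "a j (inv c \<otimes> x) \<in> U" if "- int n \<le> j" "j \<le> int (Suc m)" for j
    proof (cases "j = int (Suc m)")
      case False
      then have "a j c \<in> U" "a j x \<in> U" using that cj xw by (auto simp: window_def)
      then show ?thesis using cG xG by (simp add: flow_mult flow_inv)
    qed (use last in simp)
    moreover have "inv (c1 \<otimes> c) \<otimes> v = inv c \<otimes> x"
      using c1G cG vG by (simp add: x_def inv_mult_group m_assoc)
    ultimately have "inv (c1 \<otimes> c) \<otimes> v \<in> window {- int n..int (Suc m)} U"
      using cG xG by (auto simp: window_def)
    moreover have "c1 \<otimes> c \<in> window {..0} U"
      using c1 cj cG c1G by (auto simp: window_def flow_mult)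
    ultimately show ?case by blast
  qed
  define V where "V = window {- int n..0} U"
  have VU: "V \<subseteq> U" unfolding V_def by (rule window_subset) auto
  have V: "subgroup V G" unfolding V_def using U by (rule subgroup_window)
  have bwd: "x \<in> window {..0} V" if "x \<in> window {..0} U" for x
    using that by (auto simp: V_def window_def flow_flow)
  \<comment> \<open>The admissible factors \<open>c\<close> for each \<open>m\<close> form
    decreasing nonempty compact sets. A common element leaves a remainder whose forward orbit never
    leaves \<open>V\<close>.\<close>
  have step4: "\<exists>c\<in>window {..0} V. \<exists>b\<in>window {0..} V. v = c \<otimes> b" if v: "v \<in> V" for v
  proof -
    have vG: "v \<in> carrier G" using v V_def window_subset_carrier by auto
    define D where "D m = window {..0} U \<inter> {c \<in> carrier G. inv c \<otimes> v \<in> window {- int n..int m} U}" for m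
    have clw: "closedin T (window {..0} U)" using clU by (rule closedin_window)
    have clD: "closedin T {c \<in> carrier G. inv c \<otimes> v \<in> window J U}" for J
      using vG clU by (intro closedin_preimage closedin_window group_continuous_intros)
    have "(\<Inter>m. D m) \<noteq> {}"
    proof (rule compactin_nest)
      have "compactin T (window {..0} U)"
        using cU _ clw by (rule closed_compactin) (simp add: window_subset)
      then show "compactin T (D 0)" unfolding D_def using clD by (intro compact_Int_closedin)
      show "closedin T (D m)" for m unfolding D_def using clw clD by (rule closedin_Int)
      show "D m \<noteq> {}" for m
      proof -
        obtain c where "c \<in> window {..0} U" "inv c \<otimes> v \<in> window {- int n..int m} U"
          using step3[OF v[unfolded V_def]] by blast
        then have "c \<in> D m" using window_subset_carrier unfolding D_def by blast
        then show ?thesis by blast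
      qed
      show "D (Suc m) \<subseteq> D m" for m by (auto simp: D_def window_def)
    qed
    then obtain c where c: "\<And>m. c \<in> D m" by blast
    have cG: "c \<in> carrier G" and cw: "c \<in> window {..0} U" using c[of 0] by (auto simp: D_def)
    have "a j (inv c \<otimes> v) \<in> U" if "- int n \<le> j" for j
    proof -
      have "inv c \<otimes> v \<in> window {- int n..int (nat j)} U" using c[of "nat j"] by (auto simp: D_def)
      then show ?thesis using that by (auto simp: window_def)
    qed
    then have "inv c \<otimes> v \<in> window {0..} V" using cG vG by (auto simp: window_def V_def flow_flow)
    moreover have "v = c \<otimes> (inv c \<otimes> v)" using cG vG by (simp add: inv_mult_cancel)
    ultimately show ?thesis using bwd[OF cw] by blast
  qed
  \<comment> \<open>\<open>step4\<close> produces the factors in the order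
    \<open>V\<^sub>+V\<^sub>-\<close>; applying it to \<open>inv v\<close> reverses them.\<close>
  have "\<exists>b\<in>window {0..} V. \<exists>c\<in>window {..0} V. v = b \<otimes> c" if v: "v \<in> V" for v
  proof -
    have vG: "v \<in> carrier G" using v V_def window_subset_carrier by auto
    have "inv v \<in> V" using v V by (simp add: subgroup.m_inv_closed)
    then obtain c b where *: "c \<in> window {..0} V" "b \<in> window {0..} V" "inv v = c \<otimes> b"
      using step4 by blast
    have cG: "c \<in> carrier G" and bG: "b \<in> carrier G" using * window_subset_carrier by auto
    have "v = inv (inv v)" using vG by simp
    also have "\<dots> = inv b \<otimes> inv c" using *(3) cG bG by (simp add: inv_mult_group)
    finally have "v = inv b \<otimes> inv c" .
    moreover have "inv b \<in> window {0..} V" "inv c \<in> window {..0} V"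
      using * subgroup_window[OF V] subgroup.m_inv_closed by metis+
    ultimately show ?thesis by blast
  qed
  moreover have "compactin T V"
    using cU VU closedin_window[OF clU] unfolding V_def by (rule closed_compactin)
  \<comment> \<open>Only finitely many times occur, so this window is open, and its trace on the
    invariant group \<open>P\<close> lies in \<open>V\<close>.\<close>
  moreover have "openin T (window {- int n..0} S)" using S(2) by (rule openin_window) simp
  moreover have "\<one> \<in> window {- int n..0} S" using subgroup.one_closed[OF S(1)] by (simp add: window_def)
  moreover have "window {- int n..0} S \<inter> P \<subseteq> V" using Pa by (auto simp: window_def V_def U_def)
  ultimately have "tidy_above P V" unfolding tidy_above_def using V VU U_def by blast
  then show ?thesis using VU U_def by blast
qed

text \<open>A solution up to time \<open>M\<close> can be corrected by an element whose \<open>M\<close>-th iterate is in \<open>V\<^sub>+\<close>: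
  this keeps it a solution, and afterwards its position at time \<open>M\<close> is in \<open>V\<^sub>-\<close>, so that it is a
  solution up to time \<open>M + 1\<close>.\<close>

lemma shadowing:
  assumes V: "tidy_above P V" and u: "\<And>n. u n \<in> carrier G"
    and err: "\<And>n. inv (u (Suc n)) \<otimes> a 1 (u n) \<in> V"
  obtains y where "y \<in> carrier G" "\<And>n. inv (u n) \<otimes> a (int n) y \<in> V"
proof -
  have V_sub: "subgroup V G" and cV: "compactin T V"
    and split: "\<And>v. v \<in> V \<Longrightarrow> \<exists>b\<in>window {0..} V. \<exists>c\<in>window {..0} V. v = b \<otimes> c"
    using V unfolding tidy_above_def by blast+
  interpret V: subgroup V G by fact
  define D where "D M = {y \<in> carrier G. \<forall>n\<le>M. inv (u n) \<otimes> a (int n) y \<in> V}" for M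
  have D_ne: "D M \<noteq> {}" for M
  proof (induction M)
    case 0
    have "u 0 \<in> D 0" using u by (simp add: D_def flow_zero)
    then show ?case by blast
  next
    case (Suc M)
    then obtain y where y: "y \<in> D M" by blast
    then have yG: "y \<in> carrier G" by (simp add: D_def)
    obtain b c where bc: "b \<in> window {0..} V" "c \<in> window {..0} V"
      "inv (u M) \<otimes> a (int M) y = b \<otimes> c"
      using y split unfolding D_def by blast
    have bG: "b \<in> carrier G" and cG: "c \<in> carrier G" using bc window_subset_carrier by auto
    \<comment> \<open>The correction is \<open>inv c\<close> moved back by \<open>M\<close> steps.
      At a time \<open>n \<le> M\<close> it changes the error by a backward iterate of
      \<open>c\<close>, which is in \<open>V\<close>; at time \<open>M\<close> it removes
      \<open>c\<close> and leaves \<open>b\<close>, whose next iterate is still in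
      \<open>V\<close>.\<close>
    define z where "z = y \<otimes> a (- int M) (inv c)"
    have zG: "z \<in> carrier G" using yG cG by (simp add: z_def)
    have az: "a j z = a j y \<otimes> inv (a (j - int M) c)" for j
      using yG cG by (simp add: z_def flow_mult flow_flow flow_inv)
    have "inv (u n) \<otimes> a (int n) z \<in> V" if n: "n \<le> M" for n
    proof -
      have "a (int n - int M) c \<in> V" using bc(2) n by (simp add: window_def)
      moreover have "inv (u n) \<otimes> a (int n) y \<in> V" using y n by (simp add: D_def)
      ultimately have "(inv (u n) \<otimes> a (int n) y) \<otimes> inv (a (int n - int M) c) \<in> V" by simp
      then show ?thesis using u yG cG by (simp add: az m_assoc)
    qed
    moreover have "inv (u (Suc M)) \<otimes> a (int (Suc M)) z \<in> V"
    proof -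
      have "inv (u M) \<otimes> a (int M) z = (inv (u M) \<otimes> a (int M) y) \<otimes> inv c"
        using u yG cG by (simp add: az m_assoc flow_zero)
      also have "\<dots> = b" using bG cG by (simp add: bc(3) m_assoc)
      finally have b: "a (int M) z = u M \<otimes> b"
        using u zG bG by (metis flow_closed inv_mult_cancel(1))
      have "a (int (Suc M)) z = a 1 (a (int M) z)" using zG by (simp add: flow_flow)
      also have "\<dots> = a 1 (u M) \<otimes> a 1 b" using u bG by (simp add: b flow_mult)
      finally have "inv (u (Suc M)) \<otimes> a (int (Suc M)) z = (inv (u (Suc M)) \<otimes> a 1 (u M)) \<otimes> a 1 b"
        using u bG by (simp add: m_assoc)
      moreover have "a 1 b \<in> V" using bc(1) by (simp add: window_def)
      ultimately show ?thesis using err[of M] by simp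
    qed
    ultimately have "z \<in> D (Suc M)" using zG by (auto simp: D_def le_Suc_eq)
    then show ?case by blast
  qed
  have clV: "closedin T V" using cV by (rule compactin_closedin)
  have "closedin T (D M)" for M
  proof -
    have "D M = \<Inter> ((\<lambda>n. {y \<in> carrier G. inv (u n) \<otimes> a (int n) y \<in> V}) ` {..M})"
      by (auto simp: D_def)
    moreover have "closedin T \<dots>"
      using u clV by (intro closedin_Inter) (auto intro!: closedin_preimage group_continuous_intros flow_continuous)
    ultimately show ?thesis by simp
  qed
  \<comment> \<open>The condition at time \<open>0\<close> confines all solutions to one compact
    coset, so a solution for all times exists.\<close>
  moreover have "D 0 \<subseteq> u 0 <# V" using u V.subset by (auto simp: D_def mem_l_coset_iff flow_zero)
  moreover have "compactin T (u 0 <# V)" using u cV by (intro compactin_l_coset)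
  ultimately have "compactin T (D 0)" by (meson closed_compactin)
  then have "(\<Inter>M. D M) \<noteq> {}"
    using \<open>\<And>M. closedin T (D M)\<close> D_ne by (rule compactin_nest) (auto simp: D_def)
  then obtain y where y: "\<And>M. y \<in> D M" by blast
  show ?thesis by (rule that[of y]) (use y in \<open>auto simp: D_def\<close>)
qed

end

section \<open>Correcting and lifting contracted orbits\<close>

locale tdlc_flow = automorphism_flow + tdlc_group
begin

lemma flow_invariant_window_UNIV:
  assumes "subgroup V G" "closedin T V"
  shows "flow_invariant (window UNIV V)"
  unfolding flow_invariant_def
proof (intro conjI ballI allI)
  show "a i x \<in> window UNIV V" if "x \<in> window UNIV V" for i x
    using that by (simp add: window_def flow_flow)
qed (use assms in \<open>simp_all add: subgroup_window closedin_window\<close>)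

text \<open>The elements of \<open>\<Inter>n. a n (V\<^sub>-)\<close>, where \<open>V\<^sub>-\<close> is the set of points with forward orbit in
  \<open>V\<close>, form the compact invariant group \<open>window UNIV V\<close>. So by compactness late iterates are close
  to this group, and shadowing inside it corrects them.\<close>

lemma eventually_in_split:
  assumes V: "subgroup V G" "compactin T V" "V \<subseteq> P" and P: "subgroup P G"
    and W: "openin T W0" "\<one> \<in> W0" "W0 \<inter> P \<subseteq> W"
    and t: "t \<in> carrier G" "\<forall>\<^sub>F n in sequentially. a (int n) t \<in> V"
  obtains l where "l \<in> window UNIV V" "\<forall>\<^sub>F n in sequentially. a (int n) (inv l \<otimes> t) \<in> W"
proof -
  interpret P: subgroup P G by fact
  have clV: "closedin T V" using V(2) by (rule compactin_closedin)
  define L where "L = window UNIV V"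
  have LV: "L \<subseteq> V" unfolding L_def by (rule window_subset) simp
  have Lsub: "subgroup L G" unfolding L_def using V(1) by (rule subgroup_window)
  interpret L: subgroup L G by fact
  have Linv: "flow_invariant L" unfolding L_def using V(1) clV by (rule flow_invariant_window_UNIV)
  then have La: "a i x \<in> L" if "x \<in> L" for i x using that by (simp add: flow_invariant_def)
  obtain S1 where S1: "subgroup S1 G" "openin T S1" "compactin T S1" "S1 \<subseteq> W0"
    using compact_open_subgroup_base W(1,2) by blast
  interpret S1: subgroup S1 G by fact
  \<comment> \<open>Tidiness is taken relative to \<open>L\<close>, not to \<open>P\<close>, because
    the shadowing below has to stay inside \<open>L\<close>.\<close>
  obtain W' where W': "tidy_above L W'" "W' \<subseteq> S1"
    using tidy_above_exists[OF Linv S1(1-3)] by blast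
  obtain R where R: "openin T R" "\<one> \<in> R" "R \<inter> L \<subseteq> W'"
    using W'(1) unfolding tidy_above_def by blast
  \<comment> \<open>These neighbourhoods serve to choose \<open>S\<close> so small that
    \<open>p \<otimes> inv (a 1 q)\<close> lies in \<open>R\<close> for all \<open>p\<close> and
    \<open>q\<close> in \<open>S\<close>; the pseudo-orbit errors below have this form.\<close>
  obtain A B where AB: "openin T A" "openin T B" "\<one> \<in> A" "\<one> \<in> B"
    "\<And>x y. x \<in> A \<Longrightarrow> y \<in> B \<Longrightarrow> x \<otimes> y \<in> R"
    using nbhd_mult[OF R(1) one_closed one_closed] R(2) by auto
  have "openin T {x \<in> carrier G. inv (a 1 x) \<in> B}"
    using AB(2) by (intro openin_preimage group_continuous_intros flow_continuous)
  then have "openin T (S1 \<inter> A \<inter> {x \<in> carrier G. inv (a 1 x) \<in> B})"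
    using S1(2) AB(1) by (intro openin_Int)
  moreover have "\<one> \<in> S1 \<inter> A \<inter> {x \<in> carrier G. inv (a 1 x) \<in> B}" using AB by simp
  ultimately obtain S where S: "subgroup S G" "openin T S" "compactin T S"
    "S \<subseteq> S1 \<inter> A \<inter> {x \<in> carrier G. inv (a 1 x) \<in> B}"
    by (rule compact_open_subgroup_base)
  interpret S: subgroup S G by fact
  \<comment> \<open>As \<open>m\<close> grows these windows decrease to \<open>L\<close>, so by
    compactness one of them lies in the open set \<open>L S\<close>.\<close>
  have "\<exists>m::nat. window {- int m..} V \<subseteq> (\<Union>l\<in>L. l <# S)"
  proof (rule ccontr)
    assume neg: "\<not> ?thesis"
    have op: "openin T (\<Union>l\<in>L. l <# S)" using S(2) by (intro openin_Union) (auto intro: openin_l_coset)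
    define C where "C m = window {- int m..} V - (\<Union>l\<in>L. l <# S)" for m
    have "(\<Inter>m. C m) \<noteq> {}"
    proof (rule compactin_nest)
      show cl: "closedin T (C m)" for m
        unfolding C_def using closedin_window[OF clV] op by (rule closedin_diff)
      show "compactin T (C 0)"
        using V(2) _ cl[of 0] by (rule closed_compactin) (use window_subset[of "{0..}" V] in \<open>auto simp: C_def\<close>)
      show "C m \<noteq> {}" for m using neg by (auto simp: C_def)
      show "C (Suc m) \<subseteq> C m" for m by (auto simp: C_def window_def)
    qed
    then obtain x where x: "\<And>m. x \<in> C m" by blast
    then have xG: "x \<in> carrier G" by (simp add: C_def window_def)
    have "a j x \<in> V" for j
      using x[of "nat (- j)"] by (auto simp: C_def window_def)
    then have "x \<in> L" using xG unfolding L_def window_def by blast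
    moreover have "x \<in> x <# S" using xG S(1) by (rule lcos_self)
    ultimately show False using x[of 0] unfolding C_def by blast
  qed
  then obtain m :: nat where m: "window {- int m..} V \<subseteq> (\<Union>l\<in>L. l <# S)" by blast
  obtain k0 where k0: "\<And>n. n \<ge> k0 \<Longrightarrow> a (int n) t \<in> V"
    using t(2) unfolding eventually_sequentially by blast
  \<comment> \<open>The orbit of \<open>t\<close> is in \<open>V\<close> from time \<open>k0\<close>
    on; after \<open>m\<close> further steps its last \<open>m\<close> positions are there too, as
    the window requires.\<close>
  define M where "M = k0 + m"
  have "\<exists>l\<in>L. inv l \<otimes> a (int (M + j)) t \<in> S" for j
  proof -
    have "a i (a (int (M + j)) t) \<in> V" if "- int m \<le> i" for i
    proof -
      have "i + int (M + j) = int (nat (i + int (M + j)))" "k0 \<le> nat (i + int (M + j))"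
        using that by (auto simp: M_def)
      then show ?thesis using k0[of "nat (i + int (M + j))"] t(1) by (simp add: flow_flow)
    qed
    then have "a (int (M + j)) t \<in> window {- int m..} V" using t(1) by (simp add: window_def)
    then show ?thesis using m S.subset L.subset by (auto simp: mem_l_coset_iff subset_iff)
  qed
  then obtain u where u: "\<And>j. u j \<in> L" "\<And>j. inv (u j) \<otimes> a (int (M + j)) t \<in> S" by metis
  have uG: "u j \<in> carrier G" for j using u L.subset by auto
  have "inv (u (Suc n)) \<otimes> a 1 (u n) \<in> W'" for n
  proof -
    let ?p = "inv (u (Suc n)) \<otimes> a (int (M + Suc n)) t" and ?q = "inv (u n) \<otimes> a (int (M + n)) t"
    have qG: "?q \<in> carrier G" using uG t(1) by simp
    have "a 1 ?q = inv (a 1 (u n)) \<otimes> a (int (M + Suc n)) t"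
      using uG t(1) by (simp add: flow_mult flow_inv flow_flow add.commute)
    then have "?p \<otimes> inv (a 1 ?q) = inv (u (Suc n)) \<otimes> a 1 (u n)"
      using uG t(1) by (simp add: inv_mult_group m_assoc inv_mult_cancel)
    moreover have "?p \<in> A" "inv (a 1 ?q) \<in> B" using u(2)[of "Suc n"] u(2)[of n] S(4) by blast+
    ultimately have "inv (u (Suc n)) \<otimes> a 1 (u n) \<in> R" using AB(5) by metis
    moreover have "inv (u (Suc n)) \<otimes> a 1 (u n) \<in> L" using u(1) La by simp
    ultimately show ?thesis using R(3) by blast
  qed
  then obtain y where y: "y \<in> carrier G" "\<And>n. inv (u n) \<otimes> a (int n) y \<in> W'"
    using shadowing[OF W'(1), of u] uG by blast
  have W'L: "W' \<subseteq> L" using W'(1) by (simp add: tidy_above_def)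
  have "inv (u 0) \<otimes> y \<in> L" using y(2)[of 0] y(1) W'L by (auto simp: flow_zero)
  then have yL: "y \<in> L"
    using subgroup_mult_cancel_left[OF Lsub, of "inv (u 0)" y] u(1) y(1) by simp
  \<comment> \<open>\<open>y\<close> shadows the orbit of \<open>t\<close> counted from time
    \<open>M\<close>, so it is moved back to time \<open>0\<close>.\<close>
  define l where "l = a (- int M) y"
  have lL: "l \<in> L" unfolding l_def using yL by (rule La)
  have lG: "l \<in> carrier G" using lL by simp
  have "a (int n) (inv l \<otimes> t) \<in> W" if n: "n \<ge> M" for n
  proof -
    define i where "i = n - M"
    have ni: "int n = int (M + i)" using n by (simp add: i_def)
    have al: "a (int n) l = a (int i) y" using y(1) by (simp add: l_def flow_flow ni)
    have "inv (inv (u i) \<otimes> a (int i) y) \<otimes> (inv (u i) \<otimes> a (int (M + i)) t) = inv (a (int i) y) \<otimes> a (int n) t"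
      using uG y(1) t(1) by (simp add: inv_mult_group m_assoc inv_mult_cancel ni)
    also have "\<dots> = a (int n) (inv l \<otimes> t)" using lG t(1) by (simp add: flow_mult flow_inv al)
    finally have eq: "a (int n) (inv l \<otimes> t) =
      inv (inv (u i) \<otimes> a (int i) y) \<otimes> (inv (u i) \<otimes> a (int (M + i)) t)" ..
    have "a (int n) (inv l \<otimes> t) \<in> S1" unfolding eq
    proof (rule S1.m_closed)
      show "inv (inv (u i) \<otimes> a (int i) y) \<in> S1" using y(2)[of i] W'(2) by blast
      show "inv (u i) \<otimes> a (int (M + i)) t \<in> S1" using u(2)[of i] S(4) by blast
    qed
    moreover have "a (int n) (inv l \<otimes> t) \<in> P"
    proof -
      have "a (int n) l \<in> P" "a (int n) t \<in> P"
        using La[OF lL, of "int n"] LV V(3) k0[of n] n by (auto simp: M_def)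
      then show ?thesis using lG t(1) by (simp add: flow_mult flow_inv)
    qed
    ultimately show ?thesis using S1(4) W(3) by blast
  qed
  then have "\<forall>\<^sub>F n in sequentially. a (int n) (inv l \<otimes> t) \<in> W"
    unfolding eventually_sequentially by blast
  with lL show ?thesis unfolding L_def by (rule that)
qed

end

text \<open>Finite intersections of the members of a countable base that contain \<open>x\<close>.
  Starting with the whole space provides \<open>lift_limit\<close> with a level that is attained at
  every time.\<close>

lemma first_countable_decreasing_base:
  assumes "first_countable X" "x \<in> topspace X"
  obtains B :: "nat \<Rightarrow> 'a set" where "\<And>n. openin X (B n)" "\<And>n. x \<in> B n" "\<And>n. B (Suc n) \<subseteq> B n"
    "B 0 = topspace X" "\<And>U. openin X U \<Longrightarrow> x \<in> U \<Longrightarrow> \<exists>n. B n \<subseteq> U"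
proof -
  obtain \<B> where \<B>: "countable \<B>" "\<And>V. V \<in> \<B> \<Longrightarrow> openin X V"
    "\<And>U. openin X U \<Longrightarrow> x \<in> U \<Longrightarrow> \<exists>V\<in>\<B>. x \<in> V \<and> V \<subseteq> U"
    using assms unfolding first_countable_def by metis
  define \<C> where "\<C> = insert (topspace X) {V \<in> \<B>. x \<in> V}"
  have C: "countable \<C>" "\<C> \<noteq> {}" using \<B>(1) by (auto simp: \<C>_def)
  have C': "openin X V" "x \<in> V" if "V \<in> \<C>" for V using that \<B> assms by (auto simp: \<C>_def)
  define c where "c = from_nat_into \<C>"
  have c: "c n \<in> \<C>" for n unfolding c_def using C(2) by (rule from_nat_into)
  define B where "B n = topspace X \<inter> (\<Inter>i<n. c i)" for n
  show ?thesis
  proof (rule that[of B])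
    show "openin X (B n)" for n
    proof (induction n)
      case (Suc n)
      have "B (Suc n) = B n \<inter> c n" by (auto simp: B_def less_Suc_eq)
      then show ?case using Suc C'(1)[OF c[of n]] by (simp add: openin_Int)
    qed (simp add: B_def)
    show "x \<in> B n" for n using C'(2)[OF c] assms(2) by (simp add: B_def)
    show "B (Suc n) \<subseteq> B n" for n by (auto simp: B_def)
    show "B 0 = topspace X" by (simp add: B_def)
    fix U assume "openin X U" "x \<in> U"
    then obtain V where V: "V \<in> \<C>" "V \<subseteq> U" using \<B>(3) by (auto simp: \<C>_def)
    obtain n where "c n = V" unfolding c_def using V(1) C(1) from_nat_into_surj by metis
    then have "B (Suc n) \<subseteq> U" using V(2) by (auto simp: B_def)
    then show "\<exists>n. B n \<subseteq> U" ..
  qed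
qed

context tdlc_flow
begin

text \<open>Shadowing at a single scale only keeps the orbit within \<open>V k\<close> of a sequence
  tending to \<open>\<one>\<close>. Corrections by the compact groups \<open>L k\<close> make
  solutions at successive scales compatible, and a common limit is contracted. For a closed normal
  \<open>P\<close> this lifts contraction from the quotient by \<open>P\<close>.\<close>

lemma lift_limit:
  assumes fc: "first_countable T" and P: "flow_invariant P" and x: "x \<in> carrier G"
    and lim: "\<And>U. openin T U \<Longrightarrow> \<one> \<in> U \<Longrightarrow> \<forall>\<^sub>F n in sequentially. \<exists>u\<in>U. inv u \<otimes> a (int n) x \<in> P"
  obtains y where "y \<in> carrier G" "inv x \<otimes> y \<in> P" "limitin T (\<lambda>n. a (int n) y) \<one> sequentially"
proof -
  have Psub: "subgroup P G" and Pa: "\<And>i x. x \<in> P \<Longrightarrow> a i x \<in> P"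
    using P unfolding flow_invariant_def by auto
  interpret P: subgroup P G by fact
  obtain B :: "nat \<Rightarrow> 'a set" where B: "\<And>n. openin T (B n)" "\<And>n. \<one> \<in> B n" "\<And>n. B (Suc n) \<subseteq> B n"
    "B 0 = carrier G" "\<And>U. openin T U \<Longrightarrow> \<one> \<in> U \<Longrightarrow> \<exists>n. B n \<subseteq> U"
    using first_countable_decreasing_base[OF fc, of \<one>] topspace_eq by auto
  have Bmono: "B n \<subseteq> B m" if "m \<le> n" for m n
    using that B(3) by (rule lift_Suc_antimono_le[rotated])
  define good where "good n k \<longleftrightarrow> (\<exists>u\<in>B k. inv u \<otimes> a (int n) x \<in> P)" for n k
  \<comment> \<open>The best level attained at time \<open>n\<close>, capped by \<open>n\<close> so
    that the maximum exists. Every fixed level is eventually attained, so \<open>K n\<close> tends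
    to infinity and the representatives \<open>u n\<close> chosen at these levels tend to
    \<open>\<one>\<close>.\<close>
  define K where "K n = Max {k. k \<le> n \<and> good n k}" for n
  have K: "good n (K n)" "\<And>k. k \<le> n \<Longrightarrow> good n k \<Longrightarrow> k \<le> K n" for n
  proof -
    have fin: "finite {k. k \<le> n \<and> good n k}" by simp
    have "good n 0" unfolding good_def B(4) using x by (intro bexI[of _ "a (int n) x"]) auto
    then have "{k. k \<le> n \<and> good n k} \<noteq> {}" by blast
    with fin show "good n (K n)" unfolding K_def using Max_in by blast
    show "k \<le> K n" if "k \<le> n" "good n k" for k
      unfolding K_def using fin that by (intro Max_ge) auto
  qed
  from K(1) obtain u where u: "\<And>n. u n \<in> B (K n)" "\<And>n. inv (u n) \<otimes> a (int n) x \<in> P"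
    unfolding good_def by metis
  have uG: "u n \<in> carrier G" for n using u(1) openin_subset_carrier[OF B(1)] by blast
  have u_lim: "\<forall>\<^sub>F n in sequentially. u n \<in> U" if U: "openin T U" "\<one> \<in> U" for U
  proof -
    obtain k where k: "B k \<subseteq> U" using B(5) U by blast
    have "\<forall>\<^sub>F n in sequentially. good n k" unfolding good_def using lim B(1,2) by blast
    moreover have "\<forall>\<^sub>F n in sequentially. k \<le> n" by (rule eventually_ge_at_top)
    ultimately show ?thesis
    proof eventually_elim
      case (elim n)
      then have "B (K n) \<subseteq> B k" using K(2) Bmono by blast
      then show ?case using u(1) k by blast
    qed
  qed
  have "\<exists>V. \<forall>k. (tidy_above P (V k) \<and> V k \<subseteq> B k) \<and> V (Suc k) \<subseteq> V k"
  proof (rule dependent_nat_choice)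
    show "\<exists>V. tidy_above P V \<and> V \<subseteq> B 0"
      using compact_open_subgroup_base[OF B(1,2)] tidy_above_exists[OF P] by (metis subset_trans)
    fix V k assume "tidy_above P V \<and> V \<subseteq> B k"
    then obtain R where R: "openin T R" "\<one> \<in> R" "R \<inter> P \<subseteq> V" unfolding tidy_above_def by blast
    have "openin T (R \<inter> B (Suc k))" "\<one> \<in> R \<inter> B (Suc k)" using R B by auto
    then obtain S where S: "subgroup S G" "openin T S" "compactin T S" "S \<subseteq> R \<inter> B (Suc k)"
      by (rule compact_open_subgroup_base)
    obtain V' where V': "tidy_above P V'" "V' \<subseteq> S" using tidy_above_exists[OF P S(1-3)] by blast
    moreover from V'(1) have "V' \<subseteq> P" by (simp add: tidy_above_def)
    ultimately show "\<exists>V'. (tidy_above P V' \<and> V' \<subseteq> B (Suc k)) \<and> V' \<subseteq> V"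
      using S(4) R(3) by blast
  qed
  then obtain V where V: "\<And>k. tidy_above P (V k)" "\<And>k. V k \<subseteq> B k" "\<And>k. V (Suc k) \<subseteq> V k" by blast
  have Vsub: "subgroup (V k) G" and Vc: "compactin T (V k)" and VP: "V k \<subseteq> P" for k
    using V(1)[of k] by (simp_all add: tidy_above_def)
  \<comment> \<open>The error is a product of elements of \<open>P\<close> once it is rewritten
    through \<open>x\<close>, and it tends to \<open>\<one>\<close> together with \<open>u\<close>;
    hence it enters the relatively open subgroup \<open>V k\<close>.\<close>
  have err: "\<forall>\<^sub>F n in sequentially. inv (u (Suc n)) \<otimes> a 1 (u n) \<in> V k" for k
  proof -
    obtain R where R: "openin T R" "\<one> \<in> R" "R \<inter> P \<subseteq> V k"
      using V(1)[of k] unfolding tidy_above_def by blast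
    obtain A C where AC: "openin T A" "openin T C" "\<one> \<in> A" "\<one> \<in> C"
      "\<And>x y. x \<in> A \<Longrightarrow> y \<in> C \<Longrightarrow> x \<otimes> y \<in> R"
      using nbhd_mult[OF R(1) one_closed one_closed] R(2) by auto
    have op: "openin T {x \<in> carrier G. inv x \<in> A}" "openin T {x \<in> carrier G. a 1 x \<in> C}"
      using AC by (auto intro!: openin_preimage continuous_inv flow_continuous)
    have ev: "\<forall>\<^sub>F n in sequentially. u n \<in> {x \<in> carrier G. inv x \<in> A}"
      using AC(3) by (intro u_lim[OF op(1)]) simp
    have ev': "\<forall>\<^sub>F n in sequentially. u n \<in> {x \<in> carrier G. a 1 x \<in> C}"
      using AC(4) by (intro u_lim[OF op(2)]) simp
    have "\<forall>\<^sub>F n in sequentially. u (Suc n) \<in> {x \<in> carrier G. inv x \<in> A}"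
      using ev by (subst eventually_sequentially_Suc)
    with ev' show ?thesis
    proof eventually_elim
      case (elim n)
      let ?p = "inv (u (Suc n)) \<otimes> a (int (Suc n)) x" and ?q = "inv (u n) \<otimes> a (int n) x"
      have "a 1 ?q = inv (a 1 (u n)) \<otimes> a (int (Suc n)) x"
        using uG x by (simp add: flow_mult flow_inv flow_flow add.commute)
      then have "?p \<otimes> inv (a 1 ?q) = inv (u (Suc n)) \<otimes> a 1 (u n)"
        using uG x by (simp add: inv_mult_group m_assoc inv_mult_cancel)
      moreover have "?p \<otimes> inv (a 1 ?q) \<in> P" using u(2) Pa by blast
      moreover have "inv (u (Suc n)) \<otimes> a 1 (u n) \<in> R" using elim AC(5) by blast
      ultimately show ?case using R(3) by auto
    qed
  qed
  \<comment> \<open>Solutions are required to be correct at late times only: the errors of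
    \<open>u\<close> are in \<open>V k\<close> from some \<open>n0\<close> on, and shadowing from
    there is moved back by \<open>n0\<close>.\<close>
  define S where "S k = {y \<in> carrier G. \<forall>\<^sub>F n in sequentially. inv (u n) \<otimes> a (int n) y \<in> V k}" for k
  have S_ne: "\<exists>y. y \<in> S k" for k
  proof -
    obtain n0 where n0: "\<And>n. n \<ge> n0 \<Longrightarrow> inv (u (Suc n)) \<otimes> a 1 (u n) \<in> V k"
      using err[of k] unfolding eventually_sequentially by blast
    obtain y where y: "y \<in> carrier G" "\<And>n. inv (u (n + n0)) \<otimes> a (int n) y \<in> V k"
      using shadowing[OF V(1)[of k], of "\<lambda>n. u (n + n0)"] uG n0 by auto
    have "inv (u n) \<otimes> a (int n) (a (- int n0) y) \<in> V k" if "n \<ge> n0" for n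
      using y(2)[of "n - n0"] y(1) that by (simp add: flow_flow of_nat_diff)
    then have "a (- int n0) y \<in> S k" using y(1) by (auto simp: S_def eventually_sequentially)
    then show ?thesis by blast
  qed
  define L where "L k = window UNIV (V k)" for k
  have Lsub: "subgroup (L k) G" for k unfolding L_def using Vsub by (rule subgroup_window)
  have LG: "L k \<subseteq> carrier G" for k unfolding L_def by (rule window_subset_carrier)
  have LS: "y \<otimes> l \<in> S k" if "y \<in> S k" "l \<in> L k" for y l k
  proof -
    have yG: "y \<in> carrier G" and lG: "l \<in> carrier G" using that LG by (auto simp: S_def)
    have al: "a j l \<in> V k" for j using that by (simp add: L_def window_def)
    have "\<forall>\<^sub>F n in sequentially. inv (u n) \<otimes> a (int n) y \<in> V k" using that by (simp add: S_def)
    then have "\<forall>\<^sub>F n in sequentially. inv (u n) \<otimes> a (int n) (y \<otimes> l) \<in> V k"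
    proof eventually_elim
      case (elim n)
      then have "(inv (u n) \<otimes> a (int n) y) \<otimes> a (int n) l \<in> V k"
        using al subgroup.m_closed[OF Vsub] by blast
      then show ?case using uG yG lG by (simp add: flow_mult m_assoc)
    qed
    then show ?thesis using yG lG by (simp add: S_def)
  qed
  \<comment> \<open>Let \<open>t\<close> be the quotient of a solution at level \<open>k\<close> and
    one at level \<open>Suc k\<close>. Its orbit eventually stays in \<open>V k\<close>, so
    \<open>eventually_in_split\<close> provides the correction \<open>l\<close>.\<close>
  have next_ex: "\<exists>l\<in>L k. y \<otimes> l \<in> S (Suc k)" if y: "y \<in> S k" for y k
  proof -
    have yG: "y \<in> carrier G" using y by (simp add: S_def)
    obtain y' where y': "y' \<in> S (Suc k)" using S_ne by blast
    then have y'G: "y' \<in> carrier G" by (simp add: S_def)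
    have ev: "\<forall>\<^sub>F n in sequentially. inv (u n) \<otimes> a (int n) y \<in> V k"
      "\<forall>\<^sub>F n in sequentially. inv (u n) \<otimes> a (int n) y' \<in> V (Suc k)"
      using y y' by (simp_all add: S_def)
    define t where "t = inv y \<otimes> y'"
    have tG: "t \<in> carrier G" using yG y'G by (simp add: t_def)
    have "\<forall>\<^sub>F n in sequentially. a (int n) t \<in> V k"
      using ev
    proof eventually_elim
      case (elim n)
      have "inv (inv (u n) \<otimes> a (int n) y) \<otimes> (inv (u n) \<otimes> a (int n) y') = a (int n) t"
        using uG yG y'G by (simp add: t_def flow_mult flow_inv inv_mult_group m_assoc inv_mult_cancel)
      moreover have "inv (inv (u n) \<otimes> a (int n) y) \<otimes> (inv (u n) \<otimes> a (int n) y') \<in> V k"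
        using elim V(3)[of k] subgroup.m_closed[OF Vsub] subgroup.m_inv_closed[OF Vsub] by blast
      ultimately show ?case by simp
    qed
    moreover obtain R where R: "openin T R" "\<one> \<in> R" "R \<inter> P \<subseteq> V (Suc k)"
      using V(1)[of "Suc k"] unfolding tidy_above_def by blast
    ultimately obtain l where l: "l \<in> L k" "\<forall>\<^sub>F n in sequentially. a (int n) (inv l \<otimes> t) \<in> V (Suc k)"
      unfolding L_def using eventually_in_split[OF Vsub Vc VP Psub R tG] by blast
    have lG: "l \<in> carrier G" using l LG by auto
    have "\<forall>\<^sub>F n in sequentially. inv (u n) \<otimes> a (int n) (y \<otimes> l) \<in> V (Suc k)"
      using ev(2) l(2)
    proof eventually_elim
      case (elim n)
      have "(inv (u n) \<otimes> a (int n) y') \<otimes> inv (a (int n) (inv l \<otimes> t)) = inv (u n) \<otimes> a (int n) (y \<otimes> l)"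
        using uG yG y'G lG
        by (simp add: t_def flow_mult flow_inv inv_mult_group m_assoc inv_mult_cancel)
      moreover have "(inv (u n) \<otimes> a (int n) y') \<otimes> inv (a (int n) (inv l \<otimes> t)) \<in> V (Suc k)"
        using elim subgroup.m_closed[OF Vsub] subgroup.m_inv_closed[OF Vsub] by blast
      ultimately show ?case by simp
    qed
    then show ?thesis using l(1) yG lG by (auto simp: S_def)
  qed
  have "\<exists>Y. \<forall>k. Y k \<in> S k \<and> (\<exists>l\<in>L k. Y (Suc k) = Y k \<otimes> l)"
  proof (rule dependent_nat_choice)
    show "\<exists>y. y \<in> S 0" by (rule S_ne)
    show "\<exists>z. z \<in> S (Suc k) \<and> (\<exists>l\<in>L k. z = y \<otimes> l)" if "y \<in> S k" for y k
      using next_ex[OF that] by blast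
  qed
  then obtain Y where Y: "\<And>k. Y k \<in> S k" "\<And>k. \<exists>l\<in>L k. Y (Suc k) = Y k \<otimes> l" by blast
  have YG: "Y k \<in> carrier G" for k using Y(1)[of k] by (simp add: S_def)
  \<comment> \<open>These compact cosets are nested, and by \<open>LS\<close> the
    \<open>k\<close>-th one consists of solutions at level \<open>k\<close>. A common point
    therefore solves all levels at once.\<close>
  have "(\<Inter>k. Y k <# L k) \<noteq> {}"
  proof (rule compactin_nest)
    have cL: "compactin T (L k)" for k
    proof (rule closed_compactin)
      show "compactin T (V k)" by (rule Vc)
      show "L k \<subseteq> V k" unfolding L_def by (rule window_subset) simp
      show "closedin T (L k)" unfolding L_def using Vc by (intro closedin_window compactin_closedin)
    qed
    then have c: "compactin T (Y k <# L k)" for k using YG by (intro compactin_l_coset)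
    show "compactin T (Y 0 <# L 0)" by (rule c)
    show "closedin T (Y k <# L k)" for k using c by (rule compactin_closedin)
    show "Y k <# L k \<noteq> {}" for k using lcos_self[OF YG Lsub] by blast
    show "Y (Suc k) <# L (Suc k) \<subseteq> Y k <# L k" for k
    proof
      fix z assume "z \<in> Y (Suc k) <# L (Suc k)"
      then obtain l' where l': "l' \<in> L (Suc k)" "z = Y (Suc k) \<otimes> l'" by (auto simp: l_coset_def)
      obtain l where l: "l \<in> L k" "Y (Suc k) = Y k \<otimes> l" using Y(2) by blast
      have "l' \<in> L k" using l'(1) window_mono[OF subset_refl V(3)] unfolding L_def by blast
      then have "l \<otimes> l' \<in> L k" "z = Y k \<otimes> (l \<otimes> l')"
        using l l' LG[of k] YG subgroup.m_closed[OF Lsub] by (auto simp: m_assoc subset_iff)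
      then show "z \<in> Y k <# L k" by (auto simp: l_coset_def)
    qed
  qed
  then obtain y where y: "\<And>k. y \<in> Y k <# L k" by blast
  have yS: "y \<in> S k" for k
    using y[of k] LS[OF Y(1)] by (auto simp: l_coset_def)
  then have yG: "y \<in> carrier G" by (simp add: S_def)
  have ev: "\<forall>\<^sub>F n in sequentially. inv (u n) \<otimes> a (int n) y \<in> V k" for k
    using yS[of k] by (simp add: S_def)
  have "limitin T (\<lambda>n. a (int n) y) \<one> sequentially"
    unfolding limitin_def
  proof (intro conjI allI impI)
    show "\<one> \<in> topspace T" by (simp add: topspace_eq)
    fix U assume U: "openin T U \<and> \<one> \<in> U"
    then obtain A C where AC: "openin T A" "openin T C" "\<one> \<in> A" "\<one> \<in> C"
      "\<And>x y. x \<in> A \<Longrightarrow> y \<in> C \<Longrightarrow> x \<otimes> y \<in> U"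
      using nbhd_mult[of U \<one> \<one>] by auto
    obtain k where k: "B k \<subseteq> C" using B(5) AC(2,4) by blast
    have "\<forall>\<^sub>F n in sequentially. u n \<in> A" using AC(1,3) by (rule u_lim)
    then show "\<forall>\<^sub>F n in sequentially. a (int n) y \<in> U"
      using ev[of k]
    proof eventually_elim
      case (elim n)
      then have "inv (u n) \<otimes> a (int n) y \<in> C" using V(2) k by blast
      then have "u n \<otimes> (inv (u n) \<otimes> a (int n) y) \<in> U" using elim AC(5) by blast
      then show ?case using uG yG by (simp add: inv_mult_cancel)
    qed
  qed
  \<comment> \<open>One time \<open>n\<close> is enough: there the iterate of
    \<open>inv x \<otimes> y\<close> lies in \<open>P\<close>, and invariance brings it back to time
    \<open>0\<close>.\<close>
  moreover have "inv x \<otimes> y \<in> P"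
  proof -
    obtain n where n: "inv (u n) \<otimes> a (int n) y \<in> V 0"
      using ev[of 0] eventually_happens by fastforce
    have "inv (inv (u n) \<otimes> a (int n) x) \<otimes> (inv (u n) \<otimes> a (int n) y) = a (int n) (inv x \<otimes> y)"
      using uG x yG by (simp add: flow_mult flow_inv inv_mult_group m_assoc inv_mult_cancel)
    moreover have "inv (inv (u n) \<otimes> a (int n) x) \<otimes> (inv (u n) \<otimes> a (int n) y) \<in> P"
      using n VP u(2) by (blast intro: P.m_closed P.m_inv_closed)
    ultimately have "a (- int n) (a (int n) (inv x \<otimes> y)) \<in> P" using Pa by simp
    then show ?thesis using x yG by (simp add: flow_flow flow_zero)
  qed
  ultimately show ?thesis using yG that by blast
qed

end

section \<open>Contraction groups and quotients\<close>

lemma quotient_topology_cong: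
  assumes "\<And>x. x \<in> topspace X \<Longrightarrow> f x = g x"
  shows "quotient_topology X f = quotient_topology X g"
proof -
  have "f ` topspace X = g ` topspace X" using assms by (rule image_cong[OF refl])
  moreover have "{x \<in> topspace X. f x \<in> U} = {x \<in> topspace X. g x \<in> U}" for U
    using assms by auto
  ultimately show ?thesis by (simp add: quotient_topology_def)
qed

lemma continuous_map_quotient_topology: "continuous_map X (quotient_topology X f) f"
  unfolding continuous_map_def
  by (auto simp: topspace_quotient_topology openin_quotient_topology)

context topological_group
begin

text \<open>The saturation of \<open>U\<close> is the union of its right translates by elements of
  \<open>H\<close>.\<close>

lemma openin_l_coset_image:
  assumes "subgroup H G" "openin T U"
  shows "openin (lcoset_topology G T H) ((\<lambda>x. x <# H) ` U)"
proof -
  interpret H: subgroup H G by fact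
  have UG: "U \<subseteq> carrier G" using assms(2) by (rule openin_subset_carrier)
  have "{x \<in> carrier G. x <# H \<in> (\<lambda>x. x <# H) ` U} = (\<Union>h\<in>H. U #> h)"
  proof (intro equalityI subsetI)
    fix x assume "x \<in> {x \<in> carrier G. x <# H \<in> (\<lambda>x. x <# H) ` U}"
    then obtain u where u: "x \<in> carrier G" "u \<in> U" "u <# H = x <# H" by auto
    then have "inv u \<otimes> x \<in> H" using subgroup_l_coset_eq_iff[OF assms(1)] UG by auto
    moreover have "x = u \<otimes> (inv u \<otimes> x)" using u UG by (auto simp: inv_mult_cancel)
    ultimately show "x \<in> (\<Union>h\<in>H. U #> h)" using u by (auto simp: r_coset_def)
  next
    fix x assume "x \<in> (\<Union>h\<in>H. U #> h)"
    then obtain u h where u: "u \<in> U" "h \<in> H" "x = u \<otimes> h" by (auto simp: r_coset_def)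
    then have uG: "u \<in> carrier G" and hG: "h \<in> carrier G" using UG by auto
    then have "u <# H = x <# H"
      using u subgroup_l_coset_eq_iff[OF assms(1), of u x] by (simp add: inv_mult_cancel)
    then show "x \<in> {x \<in> carrier G. x <# H \<in> (\<lambda>x. x <# H) ` U}" using u uG hG by auto
  qed
  moreover have "openin T (\<Union>h\<in>H. U #> h)"
    using assms(2) H.subset by (intro openin_Union) (auto intro: openin_r_coset)
  ultimately show ?thesis
    using UG unfolding lcoset_topology_def openin_quotient_topology topspace_eq by auto
qed

text \<open>Distinct cosets mean that \<open>inv x \<otimes> y\<close> lies in the open complement
  of \<open>H\<close>. By continuity \<open>inv a \<otimes> b\<close> stays there for
  \<open>a\<close> near \<open>x\<close> and \<open>b\<close> near \<open>y\<close>, so the images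
  of these neighbourhoods are disjoint.\<close>

lemma Hausdorff_lcoset_topology:
  assumes H: "subgroup H G" and cl: "closedin T H"
  shows "Hausdorff_space (lcoset_topology G T H)"
  unfolding Hausdorff_space_def topspace_lcoset_topology
proof (intro allI impI)
  interpret H: subgroup H G by fact
  fix C D assume CD: "C \<in> lcosets H \<and> D \<in> lcosets H \<and> C \<noteq> D"
  then obtain x y where xy: "x \<in> carrier G" "y \<in> carrier G" "C = x <# H" "D = y <# H"
    by (auto simp: LCOSETS_def)
  then have "inv x \<otimes> y \<notin> H" using CD subgroup_l_coset_eq_iff[OF H] by blast
  then have "inv x \<otimes> y \<in> carrier G - H" using xy by simp
  moreover have "openin T (carrier G - H)" using cl by (simp add: closedin_def topspace_eq)
  ultimately obtain A' B where AB: "openin T A'" "openin T B" "inv x \<in> A'" "y \<in> B"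
    "\<And>a b. a \<in> A' \<Longrightarrow> b \<in> B \<Longrightarrow> a \<otimes> b \<in> carrier G - H"
    using nbhd_mult[of "carrier G - H" "inv x" y] xy by auto
  define A where "A = {a \<in> carrier G. inv a \<in> A'}"
  have A: "openin T A" "x \<in> A" unfolding A_def using AB xy openin_preimage[OF continuous_inv] by auto
  let ?p = "\<lambda>x. x <# H"
  have "disjnt (?p ` A) (?p ` B)"
  proof (rule ccontr)
    assume "\<not> ?thesis"
    then obtain a b where ab: "a \<in> A" "b \<in> B" "a <# H = b <# H" by (auto simp: disjnt_iff)
    have "a \<in> carrier G" "b \<in> carrier G" using ab A_def openin_subset_carrier[OF AB(2)] by auto
    then have "inv a \<otimes> b \<in> H" using ab(3) subgroup_l_coset_eq_iff[OF H] by blast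
    then show False using AB(5)[of "inv a" b] ab A_def by auto
  qed
  then show "\<exists>U V. openin (lcoset_topology G T H) U \<and> openin (lcoset_topology G T H) V \<and>
      C \<in> U \<and> D \<in> V \<and> disjnt U V"
    using A AB xy by (intro exI[of _ "?p ` A"] exI[of _ "?p ` B"])
      (simp add: openin_l_coset_image[OF H])
qed

text \<open>Left and right cosets of a normal subgroup agree. This carries openness of the
  projection and separation over to the quotient group.\<close>

lemma Mod_topology_eq_lcoset_topology:
  assumes "N \<lhd> G" shows "Mod_topology G T N = lcoset_topology G T N"
  unfolding Mod_topology_def lcoset_topology_def
  using normal.coset_eq[OF assms] by (intro quotient_topology_cong) (simp add: topspace_eq)

text \<open>\<open>N\<close> is the preimage of a point of the quotient.\<close>

lemma closedin_if_Hausdorff_Mod_topology: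
  assumes N: "N \<lhd> G" and Hd: "Hausdorff_space (Mod_topology G T N)"
  shows "closedin T N"
proof -
  interpret N: normal N G by fact
  have cont: "continuous_map T (Mod_topology G T N) (\<lambda>x. N #> x)"
    unfolding Mod_topology_def by (rule continuous_map_quotient_topology)
  have "N \<in> topspace (Mod_topology G T N)"
    unfolding topspace_Mod_topology using N.subgroup_in_rcosets[OF is_group] by (simp add: FactGroup_def)
  then have "closedin (Mod_topology G T N) {N}"
    using Hd by (simp add: closedin_Hausdorff_singleton)
  then have "closedin T {x \<in> topspace T. N #> x \<in> {N}}"
    using cont closedin_continuous_map_preimage by blast
  moreover have "{x \<in> topspace T. N #> x \<in> {N}} = N"
    using coset_join1[OF _ _ N.subgroup_axioms] coset_join2[OF _ N.subgroup_axioms] N.subset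
    by (auto simp: topspace_eq)
  ultimately show ?thesis by simp
qed

lemma coset_conjugate:
  assumes N: "N \<lhd> G" and "g \<in> carrier G" "x \<in> carrier G"
  shows "(N #> g) [^]\<^bsub>G Mod N\<^esub> (n::nat) \<otimes>\<^bsub>G Mod N\<^esub> (N #> x) \<otimes>\<^bsub>G Mod N\<^esub>
      inv\<^bsub>G Mod N\<^esub> ((N #> g) [^]\<^bsub>G Mod N\<^esub> n) = N #> (g [^] n \<otimes> x \<otimes> inv (g [^] n))"
proof -
  interpret N: normal N G by fact
  interpret M: group "G Mod N" by (rule N.factorgroup_is_group)
  interpret p: group_hom G "G Mod N" "\<lambda>x. N #> x"
    by unfold_locales (rule N.r_coset_hom_Mod)
  show ?thesis using assms by (simp add: p.hom_nat_pow p.hom_inv p.hom_mult)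
qed

text \<open>Integer powers turn conjugation by \<open>g\<close> into a flow, to which
  \<open>lift_limit\<close> applies with a closed normal subgroup as \<open>P\<close>.\<close>

lemma automorphism_flow_conjugation:
  assumes g: "g \<in> carrier G"
  shows "automorphism_flow G T (\<lambda>i x. g [^] (i::int) \<otimes> x \<otimes> inv (g [^] i))"
proof
  fix i j :: int and x y
  assume x: "x \<in> carrier G"
  show "g [^] (0::int) \<otimes> x \<otimes> inv (g [^] (0::int)) = x" using x by simp
  show "g [^] (i + j) \<otimes> x \<otimes> inv (g [^] (i + j)) =
      g [^] i \<otimes> (g [^] j \<otimes> x \<otimes> inv (g [^] j)) \<otimes> inv (g [^] i)"
    using x g by (simp add: int_pow_mult inv_mult_group m_assoc)
  assume y: "y \<in> carrier G"
  show "g [^] i \<otimes> (x \<otimes> y) \<otimes> inv (g [^] i) =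
      g [^] i \<otimes> x \<otimes> inv (g [^] i) \<otimes> (g [^] i \<otimes> y \<otimes> inv (g [^] i))"
    using x y g by (simp add: m_assoc inv_mult_cancel)
next
  fix i :: int
  show "continuous_map T T (\<lambda>x. g [^] i \<otimes> x \<otimes> inv (g [^] i))"
    using g by (intro group_continuous_intros) auto
qed

section \<open>The Tits core and density criteria\<close>

lemma contraction_group_iff:
  "x \<in> contraction_group G T g \<longleftrightarrow> x \<in> carrier G \<and>
     limitin T (\<lambda>n. g [^] int n \<otimes> x \<otimes> inv (g [^] int n)) \<one> sequentially"
  by (simp add: contraction_group_def int_pow_int)

lemma contraction_group_subset_Tits_core:
  assumes "g \<in> carrier G" shows "contraction_group G T g \<subseteq> Tits_core G T"
proof
  fix x assume "x \<in> contraction_group G T g"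
  moreover have "contraction_group G T g \<subseteq> topspace T"
    by (auto simp: contraction_group_def topspace_eq)
  ultimately have "x \<in> T closure_of contraction_group G T g" using closure_of_subset by blast
  then show "x \<in> Tits_core G T" unfolding Tits_core_def using assms by (auto intro: generate.incl)
qed

lemma Tits_core_generators: "(\<Union>g\<in>carrier G. T closure_of contraction_group G T g) \<subseteq> carrier G"
  by (intro UN_least) (simp add: closure_of_subset_topspace flip: topspace_eq)

lemma subgroup_Tits_core: "subgroup (Tits_core G T) G"
  unfolding Tits_core_def using Tits_core_generators by (rule generate_is_subgroup)

text \<open>A closed subgroup absorbs both the closures and the generated group, so only the
  contraction groups themselves have to be tested.\<close>

lemma Tits_core_subset_closed_subgroup:
  assumes S: "subgroup S G" "closedin T S" and con: "\<And>g. g \<in> carrier G \<Longrightarrow> contraction_group G T g \<subseteq> S"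
  shows "Tits_core G T \<subseteq> S" "T closure_of Tits_core G T \<subseteq> S"
proof -
  have "(\<Union>g\<in>carrier G. T closure_of contraction_group G T g) \<subseteq> S"
    by (intro UN_least closure_of_minimal con S(2))
  then show le: "Tits_core G T \<subseteq> S"
    unfolding Tits_core_def using S(1) by (rule generate_subgroup_incl)
  from le show "T closure_of Tits_core G T \<subseteq> S" using S(2) by (rule closure_of_minimal)
qed

text \<open>Conjugation by \<open>k\<close> is continuous and fixes \<open>\<one>\<close>, so it
  preserves the limit. Hence the generating set of the Tits core is stable under
  conjugation.\<close>

lemma contraction_group_conjugate:
  assumes g: "g \<in> carrier G" and k: "k \<in> carrier G" and x: "x \<in> contraction_group G T g"
  shows "k \<otimes> x \<otimes> inv k \<in> contraction_group G T (k \<otimes> g \<otimes> inv k)"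
proof -
  have xG: "x \<in> carrier G" using x by (simp add: contraction_group_def)
  have pow: "(k \<otimes> g \<otimes> inv k) [^] n = k \<otimes> g [^] n \<otimes> inv k" for n :: nat
    using g k by (induction n) (simp_all add: m_assoc inv_mult_cancel)
  have "limitin T (\<lambda>n. g [^] n \<otimes> x \<otimes> inv (g [^] n)) \<one> sequentially"
    using x by (simp add: contraction_group_def)
  moreover have "continuous_map T T (\<lambda>x. k \<otimes> x \<otimes> inv k)"
    using k by (intro group_continuous_intros) auto
  ultimately have "limitin T ((\<lambda>x. k \<otimes> x \<otimes> inv k) \<circ> (\<lambda>n. g [^] n \<otimes> x \<otimes> inv (g [^] n)))
      (k \<otimes> \<one> \<otimes> inv k) sequentially"
    by (rule continuous_map_limit[rotated])
  moreover have "(\<lambda>x. k \<otimes> x \<otimes> inv k) \<circ> (\<lambda>n::nat. g [^] n \<otimes> x \<otimes> inv (g [^] n)) =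
      (\<lambda>n. (k \<otimes> g \<otimes> inv k) [^] n \<otimes> (k \<otimes> x \<otimes> inv k) \<otimes> inv ((k \<otimes> g \<otimes> inv k) [^] n))"
    unfolding pow o_def using g k xG
    by (intro ext) (simp add: m_assoc inv_mult_group inv_mult_cancel)
  ultimately show ?thesis using g k xG by (simp add: contraction_group_def)
qed

lemma normal_closure_of_Tits_core: "T closure_of Tits_core G T \<lhd> G"
proof -
  have cont: "continuous_map T T (\<lambda>x. k \<otimes> x \<otimes> inv k)" if "k \<in> carrier G" for k
    using that by (intro group_continuous_intros) auto
  have "Tits_core G T \<lhd> G"
    unfolding Tits_core_def
  proof (rule normal_generateI[OF Tits_core_generators])
    fix h k assume k: "k \<in> carrier G" and "h \<in> (\<Union>g\<in>carrier G. T closure_of contraction_group G T g)"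
    then obtain g where g: "g \<in> carrier G" "h \<in> T closure_of contraction_group G T g" by blast
    have "(\<lambda>x. k \<otimes> x \<otimes> inv k) ` (T closure_of contraction_group G T g) \<subseteq>
        T closure_of ((\<lambda>x. k \<otimes> x \<otimes> inv k) ` contraction_group G T g)"
      using cont[OF k] by (rule continuous_map_image_closure_subset)
    also have "\<dots> \<subseteq> T closure_of contraction_group G T (k \<otimes> g \<otimes> inv k)"
      using contraction_group_conjugate[OF g(1) k] by (intro closure_of_mono) auto
    finally show "k \<otimes> h \<otimes> inv k \<in> (\<Union>g\<in>carrier G. T closure_of contraction_group G T g)"
      using g k by blast
  qed
  then have core: "k \<otimes> h \<otimes> inv k \<in> Tits_core G T" if "k \<in> carrier G" "h \<in> Tits_core G T" for h k
    using that by (simp add: normal_inv_iff)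
  show ?thesis
    unfolding normal_inv_iff
  proof (intro conjI ballI)
    show "subgroup (T closure_of Tits_core G T) G"
      using subgroup_Tits_core by (rule closure_of_subgroup)
    fix k h assume k: "k \<in> carrier G" and h: "h \<in> T closure_of Tits_core G T"
    have "(\<lambda>x. k \<otimes> x \<otimes> inv k) ` (T closure_of Tits_core G T) \<subseteq>
        T closure_of ((\<lambda>x. k \<otimes> x \<otimes> inv k) ` Tits_core G T)"
      using cont[OF k] by (rule continuous_map_image_closure_subset)
    also have "\<dots> \<subseteq> T closure_of Tits_core G T"
      using core[OF k] by (intro closure_of_mono) auto
    finally show "k \<otimes> h \<otimes> inv k \<in> T closure_of Tits_core G T" using h by blast
  qed
qed

text \<open>If nothing contracts in \<open>G Mod N\<close>, then every contraction group of
  \<open>G\<close> maps to the identity coset and so lies in \<open>N\<close>. As \<open>N\<close>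
  is closed, density forces \<open>N = carrier G\<close>.\<close>

lemma Hausdorff_quotients_contract_if_dense_Tits_core:
  assumes dense: "T closure_of Tits_core G T = carrier G"
  shows "Hausdorff_quotients_contract G T"
  unfolding Hausdorff_quotients_contract_def
proof (intro allI impI, rule ccontr)
  fix N
  assume N: "N \<lhd> G \<and> Hausdorff_space (Mod_topology G T N) \<and> carrier (G Mod N) \<noteq> {\<one>\<^bsub>G Mod N\<^esub>}"
  assume "\<not> (\<exists>g\<in>carrier (G Mod N). contraction_group (G Mod N) (Mod_topology G T N) g \<noteq> {\<one>\<^bsub>G Mod N\<^esub>})"
  then have triv: "\<And>g. g \<in> carrier (G Mod N) \<Longrightarrow>
      contraction_group (G Mod N) (Mod_topology G T N) g = {\<one>\<^bsub>G Mod N\<^esub>}" by blast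
  interpret N: normal N G using N by blast
  have carr: "N #> x \<in> carrier (G Mod N)" if "x \<in> carrier G" for x
    using that by (auto simp: FactGroup_def RCOSETS_def)
  have cont: "continuous_map T (Mod_topology G T N) (\<lambda>x. N #> x)"
    unfolding Mod_topology_def by (rule continuous_map_quotient_topology)
  have N1: "N #> \<one> = N" using coset_join2[OF one_closed N.subgroup_axioms] by simp
  have "contraction_group G T g \<subseteq> N" if g: "g \<in> carrier G" for g
  proof
    fix x assume x: "x \<in> contraction_group G T g"
    then have xG: "x \<in> carrier G" by (simp add: contraction_group_def)
    have "limitin T (\<lambda>n. g [^] n \<otimes> x \<otimes> inv (g [^] n)) \<one> sequentially"
      using x by (simp add: contraction_group_def)
    with cont have "limitin (Mod_topology G T N)
        ((\<lambda>x. N #> x) \<circ> (\<lambda>n::nat. g [^] n \<otimes> x \<otimes> inv (g [^] n))) (N #> \<one>) sequentially"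
      by (rule continuous_map_limit)
    then have "N #> x \<in> contraction_group (G Mod N) (Mod_topology G T N) (N #> g)"
      unfolding contraction_group_def mem_Collect_eq coset_conjugate[OF N.normal_axioms g xG]
      using carr[OF xG] N1 by (simp add: o_def)
    then have "N #> x = N" using triv[OF carr[OF g]] by simp
    then show "x \<in> N" using xG N.subgroup_axioms by (rule coset_join1)
  qed
  moreover have "closedin T N" using N closedin_if_Hausdorff_Mod_topology by blast
  ultimately have "T closure_of Tits_core G T \<subseteq> N"
    using Tits_core_subset_closed_subgroup(2)[OF N.subgroup_axioms] by blast
  then have "carrier G = N" using dense N.subset by simp
  then have "carrier (G Mod N) \<subseteq> {\<one>\<^bsub>G Mod N\<^esub>}"
    using coset_join2[OF _ N.subgroup_axioms] by (auto simp: FactGroup_def RCOSETS_def)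
  moreover have "\<one>\<^bsub>G Mod N\<^esub> \<in> carrier (G Mod N)" using carr[OF one_closed] N1 by simp
  ultimately show False using N by blast
qed

end

text \<open>Consider the quotient by \<open>N\<close>, the closure of the core. By
  \<open>lift_limit\<close> a contracted coset has a contracted representative; that lies in the
  core, so the coset is trivial.\<close>

lemma (in tdlc_group) dense_Tits_core_if_Hausdorff_quotients_contract:
  assumes fc: "first_countable T" and contr: "Hausdorff_quotients_contract G T"
  shows "T closure_of Tits_core G T = carrier G"
proof (rule ccontr)
  define N where "N = T closure_of Tits_core G T"
  assume "\<not> ?thesis"
  then have NG: "N \<noteq> carrier G" by (simp add: N_def)
  have N: "N \<lhd> G" unfolding N_def by (rule normal_closure_of_Tits_core)
  interpret N: normal N G by fact
  have clN: "closedin T N" unfolding N_def by simp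
  have "Hausdorff_space (Mod_topology G T N)"
    unfolding Mod_topology_eq_lcoset_topology[OF N]
    using N.subgroup_axioms clN by (rule Hausdorff_lcoset_topology)
  moreover have "carrier (G Mod N) \<noteq> {\<one>\<^bsub>G Mod N\<^esub>}"
  proof
    assume triv: "carrier (G Mod N) = {\<one>\<^bsub>G Mod N\<^esub>}"
    have "x \<in> N" if "x \<in> carrier G" for x
    proof -
      have "N #> x \<in> carrier (G Mod N)" using that by (auto simp: FactGroup_def RCOSETS_def)
      then have "N #> x = N" using triv by simp
      then show ?thesis using that N.subgroup_axioms by (rule coset_join1)
    qed
    then show False using NG N.subset by blast
  qed
  ultimately obtain C where C: "C \<in> carrier (G Mod N)"
    "contraction_group (G Mod N) (Mod_topology G T N) C \<noteq> {\<one>\<^bsub>G Mod N\<^esub>}"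
    using contr N unfolding Hausdorff_quotients_contract_def by blast
  obtain g where g: "g \<in> carrier G" "C = N #> g" using C(1) by (auto simp: FactGroup_def RCOSETS_def)
  have cont: "continuous_map T (Mod_topology G T N) (\<lambda>x. N #> x)"
    unfolding Mod_topology_def by (rule continuous_map_quotient_topology)
  have N1: "N #> \<one> = N" using coset_join2[OF one_closed N.subgroup_axioms] by simp
  have con_eq: "contraction_group (G Mod N) (Mod_topology G T N) C =
      {N #> x |x. x \<in> carrier G \<and> limitin (Mod_topology G T N)
        (\<lambda>n::nat. N #> (g [^] n \<otimes> x \<otimes> inv (g [^] n))) N sequentially}"
  proof -
    have "carrier (G Mod N) = (\<lambda>x. N #> x) ` carrier G" by (auto simp: FactGroup_def RCOSETS_def)
    moreover have "\<one>\<^bsub>G Mod N\<^esub> = N" by simp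
    ultimately show ?thesis
      unfolding contraction_group_def g(2) using coset_conjugate[OF N g(1)] by (auto simp only:)
  qed
  have "N \<in> topspace (Mod_topology G T N)"
    unfolding topspace_Mod_topology using N.subgroup_in_rcosets[OF is_group] by (simp add: FactGroup_def)
  \<comment> \<open>The identity coset is always contracted, so a contraction group other than the
    trivial one has a further element.\<close>
  then have "N \<in> contraction_group (G Mod N) (Mod_topology G T N) C"
    unfolding con_eq using g N1 by (auto intro!: exI[of _ \<one>])
  then obtain x where x: "x \<in> carrier G" "N #> x \<noteq> N"
    "limitin (Mod_topology G T N) (\<lambda>n::nat. N #> (g [^] n \<otimes> x \<otimes> inv (g [^] n))) N sequentially"
    using C(2) unfolding con_eq by auto
  interpret tdlc_flow G T "\<lambda>i x. g [^] (i::int) \<otimes> x \<otimes> inv (g [^] i)"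
    using automorphism_flow_conjugation[OF g(1)] tdlc_group_axioms
    by (simp add: tdlc_flow_def)
  have inv: "flow_invariant N"
    unfolding flow_invariant_def
    using N.subgroup_axioms clN N g(1) by (auto simp: normal_inv_iff)
  have "\<forall>\<^sub>F n in sequentially. \<exists>u\<in>U. inv u \<otimes> (g [^] int n \<otimes> x \<otimes> inv (g [^] int n)) \<in> N"
    if U: "openin T U" "\<one> \<in> U" for U
  proof -
    \<comment> \<open>The projection is open, so convergence to \<open>N\<close> in the quotient
      means that the cosets eventually meet any given neighbourhood \<open>U\<close> of
      \<open>\<one>\<close>.\<close>
    have "openin (Mod_topology G T N) ((\<lambda>x. x <# N) ` U)"
      unfolding Mod_topology_eq_lcoset_topology[OF N]
      using N.subgroup_axioms U(1) by (rule openin_l_coset_image)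
    moreover have "N \<in> (\<lambda>x. x <# N) ` U"
      using U(2) coset_join3[OF one_closed N.subgroup_axioms] by force
    ultimately have "\<forall>\<^sub>F n in sequentially. N #> (g [^] n \<otimes> x \<otimes> inv (g [^] n)) \<in> (\<lambda>x. x <# N) ` U"
      using x(3) by (auto dest: limitinD)
    then show ?thesis
    proof eventually_elim
      case (elim n)
      let ?z = "g [^] n \<otimes> x \<otimes> inv (g [^] n)"
      have zG: "?z \<in> carrier G" using g x by simp
      obtain u where u: "u \<in> U" "?z <# N = u <# N" using elim N.coset_eq zG by auto
      have "u \<in> carrier G" using u U openin_subset_carrier by auto
      then have "inv u \<otimes> ?z \<in> N"
        using u zG subgroup_l_coset_eq_iff[OF N.subgroup_axioms, of u ?z] by simp
      then show ?case using u by (auto simp: int_pow_int)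
    qed
  qed
  then obtain y where y: "y \<in> carrier G" "inv x \<otimes> y \<in> N"
    "limitin T (\<lambda>n. g [^] int n \<otimes> y \<otimes> inv (g [^] int n)) \<one> sequentially"
    using lift_limit[OF fc inv x(1)] by blast
  then have "y \<in> contraction_group G T g" by (simp add: contraction_group_iff)
  moreover have "Tits_core G T \<subseteq> N"
    unfolding N_def using subgroup.subset[OF subgroup_Tits_core] by (simp add: closure_of_subset topspace_eq)
  ultimately have yN: "y \<in> N" using contraction_group_subset_Tits_core[OF g(1)] by blast
  have "inv x \<in> N"
    using subgroup_mult_cancel_right[OF N.subgroup_axioms yN, of "inv x"] y(2) x(1) by simp
  then have "inv (inv x) \<in> N" by simp
  then have "N #> x = N" using x(1) coset_join2[OF _ N.subgroup_axioms] by simp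
  with x(2) show False ..
qed

section \<open>The invariant probability measure on \<open>G/H\<close>\<close>

locale homogeneous_prob = tdlc_group +
  fixes H :: "'a set" and M :: "'a set measure"
  assumes subgroup_H: "subgroup H G"
    and closedin_H: "closedin T H"
    and invariant: "invariant_prob G T H M"
begin

abbreviation X :: "'a set topology" where "X \<equiv> lcoset_topology G T H"
abbreviation proj :: "'a \<Rightarrow> 'a set" where "proj x \<equiv> x <# H"
abbreviation translate :: "'a \<Rightarrow> 'a set set \<Rightarrow> 'a set set" where "translate g A \<equiv> (\<lambda>C. g <# C) ` A"

lemma Radon: "Radon_prob X M"
  using invariant by (simp add: invariant_prob_def)

sublocale prob_space M
  using Radon by (simp add: Radon_prob_def)

lemma H_sub: "H \<subseteq> carrier G"
  using subgroup_H by (rule subgroup.subset)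

lemma topspace_X: "topspace X = space M"
  using Radon by (simp add: Radon_prob_def)

lemma space_eq: "space M = lcosets H"
  using topspace_X topspace_lcoset_topology by simp

lemma space_eq_image: "space M = proj ` carrier G"
  unfolding space_eq by (auto simp: LCOSETS_def)

lemma proj_in_space [simp]: "x \<in> carrier G \<Longrightarrow> proj x \<in> space M"
  by (simp add: space_eq_image)

lemma proj_eq_iff: "x \<in> carrier G \<Longrightarrow> y \<in> carrier G \<Longrightarrow> proj x = proj y \<longleftrightarrow> inv x \<otimes> y \<in> H"
  using subgroup_H by (rule subgroup_l_coset_eq_iff)

lemma act_proj: "g \<in> carrier G \<Longrightarrow> x \<in> carrier G \<Longrightarrow> g <# proj x = proj (g \<otimes> x)"
  using H_sub by (rule lcos_m_assoc)

lemma space_cases: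
  assumes "C \<in> space M" obtains x where "x \<in> carrier G" "C = proj x"
  using assms by (auto simp: space_eq_image)

lemma act_in_space [simp]: "g \<in> carrier G \<Longrightarrow> C \<in> space M \<Longrightarrow> g <# C \<in> space M"
  by (auto simp: space_eq_image act_proj)

lemma act_act: "g \<in> carrier G \<Longrightarrow> k \<in> carrier G \<Longrightarrow> C \<in> space M \<Longrightarrow> g <# (k <# C) = (g \<otimes> k) <# C"
  by (auto simp: space_eq_image act_proj m_assoc)

lemma act_one: "C \<in> space M \<Longrightarrow> \<one> <# C = C"
  by (auto simp: space_eq_image act_proj)

lemma mem_translate_iff:
  assumes "g \<in> carrier G" "A \<subseteq> space M"
  shows "C \<in> translate g A \<longleftrightarrow> C \<in> space M \<and> inv g <# C \<in> A"
proof
  assume "C \<in> translate g A"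
  then obtain D where D: "D \<in> A" "C = g <# D" by auto
  then have "D \<in> space M" using assms by auto
  then show "C \<in> space M \<and> inv g <# C \<in> A" using D assms by (simp add: act_act act_one)
next
  assume C: "C \<in> space M \<and> inv g <# C \<in> A"
  then have "C = g <# (inv g <# C)" using assms by (simp add: act_act act_one)
  then show "C \<in> translate g A" using C by blast
qed

lemma translate_subset: "g \<in> carrier G \<Longrightarrow> A \<subseteq> space M \<Longrightarrow> translate g A \<subseteq> space M"
  by auto

lemma translate_translate:
  "g \<in> carrier G \<Longrightarrow> k \<in> carrier G \<Longrightarrow> A \<subseteq> space M \<Longrightarrow> translate g (translate k A) = translate (g \<otimes> k) A"
  by (auto simp: image_image act_act subset_iff)

lemma translate_one: "A \<subseteq> space M \<Longrightarrow> translate \<one> A = A"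
  by (auto simp: act_one subset_iff image_iff)

lemma translate_proj:
  assumes "g \<in> carrier G" "U \<subseteq> carrier G"
  shows "translate g (proj ` U) = proj ` (g <# U)"
proof -
  have "g <# U = (\<lambda>u. g \<otimes> u) ` U" by (auto simp: l_coset_def)
  moreover have "translate g (proj ` U) = proj ` (\<lambda>u. g \<otimes> u) ` U"
    unfolding image_image using assms by (intro image_cong refl act_proj) auto
  ultimately show ?thesis by simp
qed

lemma inj_on_act: "g \<in> carrier G \<Longrightarrow> inj_on (\<lambda>C. g <# C) (space M)"
  by (rule inj_on_inverseI[of _ "\<lambda>C. inv g <# C"]) (simp add: act_act act_one)

lemma translate_Diff:
  assumes "g \<in> carrier G" "A \<subseteq> space M" "B \<subseteq> space M"
  shows "translate g (A - B) = translate g A - translate g B"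
  using inj_on_act[OF assms(1)] assms(2,3) by (intro inj_on_image_set_diff) auto

lemma translate_Int:
  assumes "g \<in> carrier G" "A \<subseteq> space M" "B \<subseteq> space M"
  shows "translate g (A \<inter> B) = translate g A \<inter> translate g B"
  using inj_on_act[OF assms(1)] assms(2,3) by (rule inj_on_image_Int)

lemma openin_sets: "openin X U \<Longrightarrow> U \<in> events"
  using Radon by (auto simp: Radon_prob_def)

lemma closedin_sets: "closedin X K \<Longrightarrow> K \<in> events"
proof -
  assume K: "closedin X K"
  then have "space M - K \<in> events" by (auto simp: closedin_def topspace_X intro: openin_sets)
  then have "space M - (space M - K) \<in> events" by (rule sets.compl_sets)
  moreover have "space M - (space M - K) = K" using closedin_subset[OF K] topspace_X by auto
  ultimately show ?thesis by simp
qed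

lemma Hausdorff_X: "Hausdorff_space X"
  using subgroup_H closedin_H by (rule Hausdorff_lcoset_topology)

lemma compactin_sets: "compactin X K \<Longrightarrow> K \<in> events"
  using Hausdorff_X compactin_imp_closedin closedin_sets by blast

lemma compactin_sub: "compactin X K \<Longrightarrow> K \<subseteq> space M"
  using compactin_subset_topspace topspace_X by metis

lemma openin_proj: "openin T U \<Longrightarrow> openin X (proj ` U)"
  using subgroup_H by (rule openin_l_coset_image)

lemma continuous_act:
  assumes g: "g \<in> carrier G" shows "continuous_map X X (\<lambda>C. g <# C)"
  unfolding continuous_map_def
proof (intro conjI allI impI)
  show "(\<lambda>C. g <# C) \<in> topspace X \<rightarrow> topspace X" using g by (simp add: topspace_X)
  fix U assume U: "openin X U"
  have "{x \<in> carrier G. x <# H \<in> {C \<in> topspace X. g <# C \<in> U}} =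
      {x \<in> carrier G. g \<otimes> x \<in> {y \<in> carrier G. y <# H \<in> U}}"
    using g by (auto simp: act_proj topspace_X)
  moreover have "openin T {y \<in> carrier G. y <# H \<in> U}"
    using U by (simp add: lcoset_topology_def openin_quotient_topology topspace_eq)
  then have "openin T {x \<in> carrier G. g \<otimes> x \<in> {y \<in> carrier G. y <# H \<in> U}}"
    using g by (intro openin_preimage continuous_translate)
  ultimately show "openin X {C \<in> topspace X. g <# C \<in> U}"
    unfolding lcoset_topology_def openin_quotient_topology topspace_eq
    by (auto simp: topspace_quotient_topology topspace_eq)
qed

lemma measurable_act: "g \<in> carrier G \<Longrightarrow> (\<lambda>C. g <# C) \<in> measurable M M"
proof (rule measurable_sigma_sets)
  assume g: "g \<in> carrier G"
  show "sets M = sigma_sets (topspace X) {U. openin X U}" using Radon by (simp add: Radon_prob_def)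
  show "{U. openin X U} \<subseteq> Pow (topspace X)" using openin_subset by auto
  show "(\<lambda>C. g <# C) \<in> space M \<rightarrow> topspace X" using g by (simp add: topspace_X)
  fix U assume "U \<in> {U. openin X U}"
  then have "openin X {C \<in> topspace X. g <# C \<in> U}"
    using continuous_act[OF g] openin_continuous_map_preimage by blast
  moreover have "{C \<in> topspace X. g <# C \<in> U} = (\<lambda>C. g <# C) -` U \<inter> space M"
    by (auto simp: topspace_X)
  ultimately show "(\<lambda>C. g <# C) -` U \<inter> space M \<in> events" using openin_sets by simp
qed

lemma translate_eq_vimage:
  assumes "g \<in> carrier G" "A \<subseteq> space M"
  shows "translate g A = (\<lambda>C. inv g <# C) -` A \<inter> space M"
proof (intro equalityI subsetI)
  fix C
  show "C \<in> (\<lambda>C. inv g <# C) -` A \<inter> space M" if "C \<in> translate g A"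
    using that unfolding mem_translate_iff[OF assms] by simp
  show "C \<in> translate g A" if "C \<in> (\<lambda>C. inv g <# C) -` A \<inter> space M"
    using that unfolding mem_translate_iff[OF assms] by simp
qed

lemma translate_sets [intro]:
  assumes "g \<in> carrier G" "A \<in> events" shows "translate g A \<in> events"
  using assms measurable_sets[OF measurable_act[of "inv g"] assms(2)]
  by (simp add: translate_eq_vimage sets.sets_into_space)

lemma prob_translate:
  assumes "g \<in> carrier G" "A \<in> events" shows "prob (translate g A) = prob A"
proof -
  have "distr M M (\<lambda>C. inv g <# C) = M" using invariant assms by (simp add: invariant_prob_def)
  then have "prob A = measure (distr M M (\<lambda>C. inv g <# C)) A" by simp
  also have "\<dots> = prob (translate g A)"
    using assms measurable_act[of "inv g"]
    by (simp add: measure_distr translate_eq_vimage sets.sets_into_space)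
  finally show ?thesis ..
qed

lemma inner_regular:
  assumes A: "A \<in> events" and e: "e > 0"
  obtains K where "compactin X K" "K \<subseteq> A" "prob (A - K) < e"
proof -
  have eq: "emeasure M A = (SUP K\<in>{K. compactin X K \<and> K \<subseteq> A}. emeasure M K)"
    using Radon A by (simp add: Radon_prob_def)
  have "\<exists>K. compactin X K \<and> K \<subseteq> A \<and> prob A - e < prob K"
  \<comment> \<open>A negative bound would be truncated to \<open>0\<close> by
    \<open>ennreal\<close>; in that case the empty set will do.\<close>
  proof (cases "prob A - e < 0")
    case True
    then show ?thesis using measure_nonneg[of M "{}"] by (intro exI[of _ "{}"]) auto
  next
    case False
    then have "ennreal (prob A - e) < emeasure M A"
      using e by (simp add: emeasure_eq_measure ennreal_less_iff)
    then obtain K where "compactin X K" "K \<subseteq> A" "ennreal (prob A - e) < emeasure M K"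
      unfolding eq less_SUP_iff by blast
    then show ?thesis using False by (auto simp: emeasure_eq_measure ennreal_less_iff)
  qed
  then obtain K where K: "compactin X K" "K \<subseteq> A" "prob A - e < prob K" by blast
  moreover have "prob (A - K) = prob A - prob K"
    using A K compactin_sets by (intro finite_measure_Diff) auto
  ultimately show ?thesis using that by simp
qed

text \<open>The action is transitive, so a compact set of positive measure is covered by finitely
  many translates of \<open>U\<close>; all of them would be null if \<open>U\<close> were.\<close>

lemma prob_open_pos:
  assumes U: "openin X U" "U \<noteq> {}" shows "prob U > 0"
proof (rule ccontr)
  assume "\<not> prob U > 0"
  then have U0: "prob U = 0" using measure_nonneg[of M U] by linarith
  have US: "U \<subseteq> space M" using openin_subset[OF U(1)] topspace_X by simp
  obtain x where x: "x \<in> carrier G" "proj x \<in> U" using U(2) US by (auto simp: space_eq_image)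
  obtain K where K: "compactin X K" "K \<subseteq> space M" "prob (space M - K) < 1"
    using inner_regular[OF sets.top, of 1] by auto
  let ?\<U> = "(\<lambda>g. translate g U) ` carrier G"
  have "openin X (translate g U)" if g: "g \<in> carrier G" for g
  proof -
    have "openin X {C \<in> topspace X. inv g <# C \<in> U}"
      using continuous_act[of "inv g"] g U(1) openin_continuous_map_preimage by blast
    moreover have "{C \<in> topspace X. inv g <# C \<in> U} = translate g U"
      using g US by (auto simp: translate_eq_vimage topspace_X)
    ultimately show ?thesis by simp
  qed
  moreover have "K \<subseteq> \<Union>?\<U>"
  proof
    fix C assume "C \<in> K"
    then obtain y where y: "y \<in> carrier G" "C = proj y" using K(2) by (auto simp: space_eq_image)
    have "(y \<otimes> inv x) <# proj x = proj y" using x y by (simp add: act_proj m_assoc)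
    then have "C \<in> translate (y \<otimes> inv x) U" using x(2) y by force
    then show "C \<in> \<Union>?\<U>" using x y by blast
  qed
  ultimately obtain F where F: "finite F" "F \<subseteq> ?\<U>" "K \<subseteq> \<Union>F"
    using compactinD[OF K(1), of ?\<U>] by blast
  have "\<Union>F \<in> null_sets M"
  proof -
    have "translate g U \<in> null_sets M" if "g \<in> carrier G" for g
      using that U0 prob_translate[OF that openin_sets[OF U(1)]] openin_sets[OF U(1)]
      by (auto simp: null_sets_def emeasure_eq_measure)
    then have "F \<subseteq> null_sets M" using F(2) by auto
    then show ?thesis using F(1) by (auto intro: null_sets.finite_Union)
  qed
  then have "K \<in> null_sets M" using compactin_sets[OF K(1)] F(3) by (rule null_sets_subset)
  then have "prob K = 0" by (simp add: measure_eq_0_null_sets)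
  moreover have "prob (space M - K) = 1 - prob K" using compactin_sets[OF K(1)] by (rule prob_compl)
  ultimately show False using K(3) by simp
qed

text \<open>Around each point of \<open>K\<close> take a subgroup \<open>V x\<close> for which even
  two successive moves avoid \<open>K'\<close>: one accounts for the position in the covering orbit,
  the other for the translation. By compactness finitely many points suffice.\<close>

lemma separate_compact:
  assumes K: "compactin X K" and K': "compactin X K'" and disj: "K \<inter> K' = {}"
  obtains V where "subgroup V G" "openin T V" "compactin T V" "\<And>v. v \<in> V \<Longrightarrow> translate v K \<inter> K' = {}"
proof -
  have "openin X (space M - K')"
    using compactin_imp_closedin[OF Hausdorff_X K'] by (simp add: closedin_def topspace_X)
  then have op: "openin T {y \<in> carrier G. proj y \<in> space M - K'}"
    by (simp add: lcoset_topology_def openin_quotient_topology topspace_eq)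
  have "\<exists>V. subgroup V G \<and> openin T V \<and> (\<forall>v\<in>V. \<forall>w\<in>V. proj (v \<otimes> w \<otimes> x) \<notin> K')"
    if x: "x \<in> carrier G" "proj x \<in> K" for x
  proof -
    have "openin T {y \<in> carrier G. y \<otimes> x \<in> {y \<in> carrier G. proj y \<in> space M - K'}}"
      using x op by (intro openin_preimage group_continuous_intros)
    moreover have "\<one> \<in> {y \<in> carrier G. y \<otimes> x \<in> {y \<in> carrier G. proj y \<in> space M - K'}}"
      using x disj by auto
    ultimately obtain V where V: "subgroup V G" "openin T V"
      "V \<subseteq> {y \<in> carrier G. y \<otimes> x \<in> {y \<in> carrier G. proj y \<in> space M - K'}}"
      by (rule compact_open_subgroup_base)
    have "proj (v \<otimes> w \<otimes> x) \<notin> K'" if "v \<in> V" "w \<in> V" for v w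
      using V(3) subgroup.m_closed[OF V(1) that] by blast
    then show ?thesis using V by blast
  qed
  then obtain V where V: "\<And>x. x \<in> carrier G \<Longrightarrow> proj x \<in> K \<Longrightarrow>
      subgroup (V x) G \<and> openin T (V x) \<and> (\<forall>v\<in>V x. \<forall>w\<in>V x. proj (v \<otimes> w \<otimes> x) \<notin> K')"
    by metis
  define Y where "Y = {x \<in> carrier G. proj x \<in> K}"
  let ?O = "\<lambda>x. proj ` (V x #> x)"
  have "\<And>U. U \<in> ?O ` Y \<Longrightarrow> openin X U"
    using V by (auto simp: Y_def intro!: openin_proj openin_r_coset)
  moreover have "K \<subseteq> \<Union> (?O ` Y)"
  proof
    fix C assume C: "C \<in> K"
    then obtain x where x: "x \<in> carrier G" "C = proj x"
      using compactin_sub[OF K] space_cases by blast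
    then have "x \<in> Y" using C by (simp add: Y_def)
    moreover have "x \<in> V x #> x" using x C V[of x] by (auto intro: rcos_self)
    ultimately show "C \<in> \<Union> (?O ` Y)" using x by blast
  qed
  ultimately obtain F where F: "finite F" "F \<subseteq> ?O ` Y" "K \<subseteq> \<Union>F"
    using compactinD[OF K, of "?O ` Y"] by blast
  obtain E where E: "E \<subseteq> Y" "finite E" "F = ?O ` E"
    using finite_subset_image[OF F(1,2)] by blast
  define W where "W = \<Inter> (insert (carrier G) (V ` E))"
  have VE: "subgroup (V x) G" "openin T (V x)" if "x \<in> E" for x
    using V[of x] E(1) that by (auto simp: Y_def)
  have "openin T W" unfolding W_def
    using E(2) VE(2) openin_carrier by (intro openin_Inter) auto
  moreover have "\<one> \<in> W" using subgroup.one_closed[OF VE(1)] by (auto simp: W_def)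
  ultimately obtain S where S: "subgroup S G" "openin T S" "compactin T S" "S \<subseteq> W"
    by (rule compact_open_subgroup_base)
  have "translate v K \<inter> K' = {}" if v: "v \<in> S" for v
  proof (rule ccontr)
    assume "translate v K \<inter> K' \<noteq> {}"
    then obtain C where C: "C \<in> K" "v <# C \<in> K'" by auto
    then obtain x where x: "x \<in> E" "C \<in> ?O x" using F(3) E(3) by blast
    then obtain w where w: "w \<in> V x" "C = proj (w \<otimes> x)" by (auto simp: r_coset_def)
    have xG: "x \<in> carrier G" "proj x \<in> K" using x E by (auto simp: Y_def)
    have wG: "w \<in> carrier G" using w V[OF xG] subgroup.subset by blast
    have vV: "v \<in> V x" using v S(4) x by (auto simp: W_def)
    have vG: "v \<in> carrier G" using vV V[OF xG] subgroup.subset by blast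
    have "v <# C = proj (v \<otimes> w \<otimes> x)" using w xG wG vG by (simp add: act_proj m_assoc)
    then show False using C(2) V[OF xG] vV w by auto
  qed
  then show ?thesis using that S by blast
qed

section \<open>The defect of a set under translation\<close>

definition defect :: "'a set set \<Rightarrow> 'a \<Rightarrow> real" where
  "defect A g = prob (sym_diff (translate g A) A)"

lemma prob_sym_diff_triangle:
  assumes "A \<in> events" "B \<in> events" "C \<in> events"
  shows "prob (sym_diff A C) \<le> prob (sym_diff A B) + prob (sym_diff B C)"
proof -
  have "prob (sym_diff A C) \<le> prob (sym_diff A B \<union> sym_diff B C)"
    using assms by (intro finite_measure_mono) auto
  also have "\<dots> \<le> prob (sym_diff A B) + prob (sym_diff B C)"
    using assms by (intro measure_Un_le) auto
  finally show ?thesis .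
qed

lemma prob_sym_diff_translate:
  assumes "g \<in> carrier G" "A \<in> events" "B \<in> events"
  shows "prob (sym_diff (translate g A) (translate g B)) = prob (sym_diff A B)"
proof -
  have AB: "A \<subseteq> space M" "B \<subseteq> space M" using assms sets.sets_into_space by auto
  have "sym_diff (translate g A) (translate g B) = translate g (sym_diff A B)"
    using assms(1) AB by (simp add: translate_Diff image_Un)
  then show ?thesis using assms prob_translate[of g "sym_diff A B"] by simp
qed

lemma defect_nonneg: "defect A g \<ge> 0"
  by (simp add: defect_def)

lemma defect_one: "A \<in> events \<Longrightarrow> defect A \<one> = 0"
  using sets.sets_into_space[of A M] by (simp add: defect_def translate_one)

lemma defect_mult:
  assumes "A \<in> events" "g \<in> carrier G" "k \<in> carrier G"
  shows "defect A (g \<otimes> k) \<le> defect A g + defect A k"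
proof -
  have A: "A \<subseteq> space M" using assms sets.sets_into_space by auto
  have "defect A (g \<otimes> k) \<le>
      prob (sym_diff (translate g (translate k A)) (translate g A)) + prob (sym_diff (translate g A) A)"
    unfolding defect_def translate_translate[OF assms(2,3) A, symmetric]
    using assms by (intro prob_sym_diff_triangle translate_sets)
  also have "prob (sym_diff (translate g (translate k A)) (translate g A)) = defect A k"
    unfolding defect_def using assms by (intro prob_sym_diff_translate) auto
  finally show ?thesis by (simp add: defect_def)
qed

lemma defect_inv:
  assumes "A \<in> events" "g \<in> carrier G" shows "defect A (inv g) = defect A g"
proof -
  have A: "A \<subseteq> space M" using assms sets.sets_into_space by auto
  have "defect A (inv g) = prob (sym_diff (translate g (translate (inv g) A)) (translate g A))"
    unfolding defect_def using assms by (intro prob_sym_diff_translate[symmetric]) auto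
  also have "translate g (translate (inv g) A) = A"
    using assms A by (simp add: translate_translate translate_one)
  also have "prob (sym_diff A (translate g A)) = defect A g"
    unfolding defect_def by (simp add: Un_commute)
  finally show ?thesis .
qed

text \<open>Inner regularity replaces \<open>A\<close> and its complement by compact sets
  \<open>K\<close> and \<open>K'\<close>. A small \<open>v\<close> keeps \<open>K\<close> away from
  \<open>K'\<close>, so what leaves \<open>A\<close> is covered by the translate of
  \<open>A - K\<close> and by the part of the complement outside \<open>K'\<close>.\<close>

lemma defect_small:
  assumes A: "A \<in> events" and e: "e > 0"
  obtains V where "subgroup V G" "openin T V" "compactin T V" "\<And>v. v \<in> V \<Longrightarrow> defect A v < e"
proof -
  have AS: "A \<subseteq> space M" using A by (rule sets.sets_into_space)
  obtain K where K: "compactin X K" "K \<subseteq> A" "prob (A - K) < e / 4"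
    using inner_regular[OF A, of "e / 4"] e by auto
  obtain K' where K': "compactin X K'" "K' \<subseteq> space M - A" "prob (space M - A - K') < e / 4"
    using inner_regular[of "space M - A" "e / 4"] A e by auto
  have KK: "K \<in> events" "K' \<in> events" using K K' compactin_sets by auto
  have "K \<inter> K' = {}" using K(2) K'(2) by blast
  then obtain V where V: "subgroup V G" "openin T V" "compactin T V"
      "\<And>v. v \<in> V \<Longrightarrow> translate v K \<inter> K' = {}"
    using separate_compact[OF K(1) K'(1)] by blast
  have le: "prob (translate v A - A) < e / 2" if v: "v \<in> V" for v
  proof -
    have vG: "v \<in> carrier G" using v V(1) subgroup.subset by blast
    have tr: "translate v A \<subseteq> space M" using vG AS by (rule translate_subset)
    have "translate v A - A \<subseteq> translate v (A - K) \<union> (space M - A - K')"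
      using V(4)[OF v] tr by auto
    then have "prob (translate v A - A) \<le> prob (translate v (A - K) \<union> (space M - A - K'))"
      using vG A KK by (intro finite_measure_mono) auto
    also have "\<dots> \<le> prob (translate v (A - K)) + prob (space M - A - K')"
      using vG A KK by (intro measure_Un_le) auto
    also have "prob (translate v (A - K)) = prob (A - K)" using vG A KK by (intro prob_translate) auto
    finally show ?thesis using K(3) K'(3) by simp
  qed
  have "defect A v < e" if v: "v \<in> V" for v
  proof -
    have vG: "v \<in> carrier G" using v V(1) subgroup.subset by blast
    \<comment> \<open>The other half of the symmetric difference is a translate of the first half
      for \<open>inv v\<close>, and \<open>V\<close> is closed under inverses.\<close>
    have "prob (A - translate v A) = prob (translate (inv v) (A - translate v A))"
      using vG A by (intro prob_translate[symmetric]) auto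
    also have "translate (inv v) (A - translate v A) = translate (inv v) A - A"
      using vG AS by (simp add: translate_Diff translate_subset translate_translate translate_one)
    also have "prob \<dots> < e / 2" using le[of "inv v"] v V(1) by (simp add: subgroup.m_inv_closed)
    finally have "prob (A - translate v A) < e / 2" .
    moreover have "defect A v \<le> prob (translate v A - A) + prob (A - translate v A)"
      unfolding defect_def using vG A by (intro measure_Un_le) auto
    ultimately show ?thesis using le[OF v] by simp
  qed
  then show ?thesis using that V by blast
qed

text \<open>Poincare recurrence for the image of a small open subgroup.\<close>

lemma defect_recurrent:
  assumes A: "A \<in> events" and H0: "\<And>h. h \<in> H \<Longrightarrow> defect A h = 0" and g: "g \<in> carrier G" and e: "e > 0"
  obtains n :: nat where "n \<ge> m" "defect A (g [^] n) < e"
proof -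
  obtain V where V: "subgroup V G" "openin T V" "compactin T V" "\<And>v. v \<in> V \<Longrightarrow> defect A v < e / 2"
    using defect_small[OF A, of "e / 2"] e by auto
  have VG: "V \<subseteq> carrier G" using V(1) by (rule subgroup.subset)
  define B where "B = proj ` V"
  have B: "openin X B" unfolding B_def using V(2) by (rule openin_proj)
  have Bs: "B \<in> events" using B by (rule openin_sets)
  have "B \<noteq> {}" using subgroup.one_closed[OF V(1)] by (auto simp: B_def)
  then have pos: "prob B > 0" using B by (intro prob_open_pos)
  \<comment> \<open>Steps of length \<open>Suc m\<close> ensure that the return time is at least
    \<open>m\<close>.\<close>
  define E where "E i = translate (g [^] (i * Suc m)) B" for i :: nat
  have Es: "E i \<in> events" for i unfolding E_def using g Bs by (intro translate_sets) auto
  have "\<exists>i j. i < j \<and> E i \<inter> E j \<noteq> {}"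
  proof (rule ccontr)
    assume neg: "\<not> ?thesis"
    \<comment> \<open>Pairwise disjoint translates of the same positive measure would exceed total
      mass \<open>1\<close>.\<close>
    obtain N :: nat where N: "real N * prob B > 1"
      using pos reals_Archimedean3 by blast
    have "disjoint_family_on E {..<N}"
      unfolding disjoint_family_on_def using neg by (metis Int_commute nat_neq_iff)
    then have "prob (\<Union>i\<in>{..<N}. E i) = (\<Sum>i<N. prob (E i))"
      using Es by (intro finite_measure_finite_Union) auto
    also have "\<dots> = real N * prob B"
      unfolding E_def using g Bs by (simp add: prob_translate)
    finally show False using N prob_le_1[of "\<Union>i\<in>{..<N}. E i"] by linarith
  qed
  then obtain i j C where ij: "i < j" "C \<in> E i" "C \<in> E j" by blast
  define p q where "p = i * Suc m" and "q = (j - i) * Suc m"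
  have pq: "j * Suc m = p + q" using ij(1) by (simp add: p_def q_def flip: add_mult_distrib)
  obtain v w where vw: "v \<in> V" "w \<in> V" "C = g [^] p <# proj v" "C = g [^] (p + q) <# proj w"
    using ij(2,3) unfolding E_def B_def p_def[symmetric] pq by auto
  have vG: "v \<in> carrier G" and wG: "w \<in> carrier G" using vw VG by auto
  have gp: "g [^] p \<in> carrier G" "g [^] q \<in> carrier G" using g by auto
  have "proj (g [^] p \<otimes> v) = proj (g [^] (p + q) \<otimes> w)"
    using vw(3,4) g vG wG by (simp add: act_proj)
  then have "inv (g [^] p \<otimes> v) \<otimes> (g [^] (p + q) \<otimes> w) \<in> H"
    using g vG wG by (simp add: proj_eq_iff)
  moreover have "inv (g [^] p \<otimes> v) \<otimes> (g [^] (p + q) \<otimes> w) = inv v \<otimes> (g [^] q \<otimes> w)"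
    using gp vG wG g by (simp add: nat_pow_mult[symmetric] inv_mult_group m_assoc inv_mult_cancel)
  ultimately have h: "inv v \<otimes> (g [^] q \<otimes> w) \<in> H" (is "?h \<in> H") by simp
  then have hG: "?h \<in> carrier G" using H_sub by auto
  \<comment> \<open>A common point of the two translates exhibits the power as an element of
    \<open>V H V\<close>, and only the two factors in \<open>V\<close> contribute to the
    defect.\<close>
  have "g [^] q = (v \<otimes> ?h) \<otimes> inv w"
    using gp vG wG by (simp add: m_assoc inv_mult_cancel)
  then have "defect A (g [^] q) \<le> defect A (v \<otimes> ?h) + defect A (inv w)"
    using A vG wG hG by (metis defect_mult inv_closed m_closed)
  also have "\<dots> \<le> (defect A v + defect A ?h) + defect A (inv w)"
    using A vG hG by (intro add_right_mono defect_mult)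
  also have "\<dots> < e"
    using H0[OF h] V(4)[OF vw(1)] V(4)[OF vw(2)] defect_inv[OF A wG] by simp
  finally have "defect A (g [^] q) < e" .
  moreover have "m \<le> q"
  proof -
    have "1 * Suc m \<le> (j - i) * Suc m" using ij(1) by (intro mult_le_mono1) simp
    then show ?thesis by (simp add: q_def)
  qed
  ultimately show ?thesis using that by blast
qed

lemma defect_contraction_group:
  assumes A: "A \<in> events" and H0: "\<And>h. h \<in> H \<Longrightarrow> defect A h = 0"
    and g: "g \<in> carrier G" and x: "x \<in> contraction_group G T g"
  shows "defect A x = 0"
proof (rule ccontr)
  assume "defect A x \<noteq> 0"
  then have pos: "defect A x > 0" using defect_nonneg[of A x] by linarith
  \<comment> \<open>The estimate has three terms: the defect of \<open>g [^] n\<close> twice and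
    that of the conjugate of \<open>x\<close> once.\<close>
  define e where "e = defect A x / 3"
  have e: "e > 0" using pos by (simp add: e_def)
  have xG: "x \<in> carrier G" using x by (simp add: contraction_group_def)
  obtain V where V: "subgroup V G" "openin T V" "compactin T V" "\<And>v. v \<in> V \<Longrightarrow> defect A v < e"
    using defect_small[OF A e] by blast
  have "limitin T (\<lambda>n::nat. g [^] n \<otimes> x \<otimes> inv (g [^] n)) \<one> sequentially"
    using x by (simp add: contraction_group_def)
  then have "\<forall>\<^sub>F n::nat in sequentially. g [^] n \<otimes> x \<otimes> inv (g [^] n) \<in> V"
    using V(2) subgroup.one_closed[OF V(1)] by (rule limitinD)
  then obtain m where m: "\<And>n::nat. n \<ge> m \<Longrightarrow> g [^] n \<otimes> x \<otimes> inv (g [^] n) \<in> V"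
    unfolding eventually_sequentially by blast
  obtain n where n: "n \<ge> m" "defect A (g [^] n) < e"
    using defect_recurrent[OF A H0 g e] by blast
  define k y where "k = g [^] n" and "y = k \<otimes> x \<otimes> inv k"
  have kG: "k \<in> carrier G" and yG: "y \<in> carrier G" using g xG by (auto simp: k_def y_def)
  have "x = (inv k \<otimes> y) \<otimes> k" using kG xG by (simp add: y_def m_assoc inv_mult_cancel)
  then have "defect A x \<le> defect A (inv k \<otimes> y) + defect A k"
    using A kG yG by (metis defect_mult inv_closed m_closed)
  also have "\<dots> \<le> (defect A (inv k) + defect A y) + defect A k"
    using A kG yG by (intro add_right_mono defect_mult) auto
  also have "\<dots> < 3 * e"
    using n(2) V(4)[OF m[OF n(1)]] defect_inv[OF A kG] by (simp add: k_def y_def)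
  finally show False by (simp add: e_def)
qed

text \<open>The zero set \<open>S\<close> of the defect is a subgroup by subadditivity, and closed
  because a small perturbation of \<open>x\<close> changes its defect by less than
  \<open>defect A x\<close>. It contains the contraction groups, hence the closure of the
  core.\<close>

lemma defect_eq_0:
  assumes dense: "T closure_of Tits_core G T = carrier G"
    and A: "A \<in> events" and H0: "\<And>h. h \<in> H \<Longrightarrow> defect A h = 0" and g: "g \<in> carrier G"
  shows "defect A g = 0"
proof -
  define S where "S = {x \<in> carrier G. defect A x = 0}"
  have S: "subgroup S G"
  proof (rule subgroupI)
    show "x \<otimes> y \<in> S" if "x \<in> S" "y \<in> S" for x y
      using that A defect_mult[of A x y] defect_nonneg[of A "x \<otimes> y"] by (auto simp: S_def)
    have "\<one> \<in> S" using A by (simp add: S_def defect_one)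
    then show "S \<noteq> {}" by blast
  qed (auto simp: S_def defect_inv A)
  have "\<exists>U. openin T U \<and> x \<in> U \<and> U \<subseteq> carrier G - S" if x: "x \<in> carrier G - S" for x
  proof -
    have xG: "x \<in> carrier G" using x by simp
    have "defect A x > 0" using x defect_nonneg[of A x] by (auto simp: S_def less_le)
    then obtain V where V: "subgroup V G" "openin T V" "compactin T V" "\<And>v. v \<in> V \<Longrightarrow> defect A v < defect A x"
      using defect_small[OF A] by blast
    have VG: "V \<subseteq> carrier G" using V(1) by (rule subgroup.subset)
    have "x \<otimes> v \<notin> S" if v: "v \<in> V" for v
    proof
      assume xv: "x \<otimes> v \<in> S"
      have vG: "v \<in> carrier G" using v VG by auto
      have "x = (x \<otimes> v) \<otimes> inv v" using xG vG by (simp add: m_assoc)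
      then have "defect A x \<le> defect A (x \<otimes> v) + defect A (inv v)"
        using A xG vG by (metis defect_mult inv_closed m_closed)
      then show False using xv V(4)[OF v] defect_inv[OF A vG] by (simp add: S_def)
    qed
    then have "x <# V \<subseteq> carrier G - S" using xG VG by (auto simp: l_coset_def)
    then show ?thesis
      using openin_l_coset[OF xG V(2)] lcos_self[OF xG V(1)] by blast
  qed
  then have "openin T (carrier G - S)" by (subst openin_subopen) blast
  then have "closedin T S" by (auto simp: closedin_def topspace_eq S_def)
  moreover have "contraction_group G T k \<subseteq> S" if k: "k \<in> carrier G" for k
  proof
    fix x assume x: "x \<in> contraction_group G T k"
    have "defect A x = 0" using H0 by (rule defect_contraction_group[OF A _ k x])
    then show "x \<in> S" using x by (simp add: S_def contraction_group_def)
  qed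
  ultimately have "T closure_of Tits_core G T \<subseteq> S"
    using S by (intro Tits_core_subset_closed_subgroup)
  then show ?thesis using dense g by (auto simp: S_def)
qed

end

section \<open>Ergodicity\<close>

context topological_group
begin

definition compact_open_subgroup :: "'a set \<Rightarrow> bool" where
  "compact_open_subgroup V \<longleftrightarrow> subgroup V G \<and> openin T V \<and> compactin T V"

lemma compact_open_subgroupD:
  assumes "compact_open_subgroup V"
  shows "subgroup V G" "openin T V" "compactin T V" "closedin T V" "V \<subseteq> carrier G"
  using assms compactin_closedin subgroup.subset unfolding compact_open_subgroup_def by blast+

lemma compact_open_subgroup_Int:
  assumes "compact_open_subgroup U" "compact_open_subgroup V"
  shows "compact_open_subgroup (U \<inter> V)"
  using compact_open_subgroupD[OF assms(1)] compact_open_subgroupD[OF assms(2)]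
  by (simp add: compact_open_subgroup_def subgroups_Inter_pair openin_Int compact_Int_closedin)

lemma compact_open_subgroup_conjugate:
  assumes V: "compact_open_subgroup V" and x: "x \<in> carrier G"
  shows "compact_open_subgroup {y \<in> carrier G. x \<otimes> y \<otimes> inv x \<in> V}" (is "compact_open_subgroup ?W")
proof -
  interpret V: subgroup V G using V by (rule compact_open_subgroupD)
  have sub: "subgroup ?W G"
  proof (rule subgroupI)
    have "\<one> \<in> ?W" using x by simp
    then show "?W \<noteq> {}" by blast
    show "inv y \<in> ?W" if y: "y \<in> ?W" for y
    proof -
      have "inv (x \<otimes> y \<otimes> inv x) \<in> V" using y by simp
      then show ?thesis using x y by (simp add: inv_mult_group m_assoc)
    qed
    show "y \<otimes> z \<in> ?W" if yz: "y \<in> ?W" "z \<in> ?W" for y z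
    proof -
      have "(x \<otimes> y \<otimes> inv x) \<otimes> (x \<otimes> z \<otimes> inv x) \<in> V" using yz by simp
      then show ?thesis using x yz by (simp add: m_assoc inv_mult_cancel)
    qed
  qed auto
  have op: "openin T ?W"
    using x compact_open_subgroupD(2)[OF V] by (intro openin_preimage group_continuous_intros) auto
  have cont: "continuous_map T T (\<lambda>y. inv x \<otimes> y \<otimes> x)"
    using x by (intro group_continuous_intros) auto
  have "?W \<subseteq> (\<lambda>y. inv x \<otimes> y \<otimes> x) ` V"
  proof
    fix y assume y: "y \<in> ?W"
    then have "y = inv x \<otimes> (x \<otimes> y \<otimes> inv x) \<otimes> x" using x by (simp add: m_assoc inv_mult_cancel)
    then show "y \<in> (\<lambda>y. inv x \<otimes> y \<otimes> x) ` V" using y by blast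
  qed
  then have "compactin T ?W"
    using image_compactin[OF compact_open_subgroupD(3)[OF V] cont] open_subgroup_closedin[OF sub op]
    by (meson closed_compactin)
  then show ?thesis using sub op by (simp add: compact_open_subgroup_def)
qed

text \<open>\<open>N\<close> is the intersection of the conjugates of \<open>V\<close> by elements
  \<open>u\<close> of \<open>U\<close>. Such a conjugate depends only on the coset
  \<open>u <# V\<close>, and the compact group \<open>U\<close> meets finitely many of these, so
  \<open>N\<close> is open.\<close>

lemma normal_core:
  assumes U: "compact_open_subgroup U" and V: "compact_open_subgroup V"
  obtains N where "compact_open_subgroup N" "N \<subseteq> V" "\<And>u n. u \<in> U \<Longrightarrow> n \<in> N \<Longrightarrow> u \<otimes> n \<otimes> inv u \<in> N"
proof -
  interpret U: subgroup U G using U by (rule compact_open_subgroupD)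
  interpret V: subgroup V G using V by (rule compact_open_subgroupD)
  define N where "N = {x \<in> carrier G. \<forall>u\<in>U. inv u \<otimes> x \<otimes> u \<in> V}"
  have NV: "N \<subseteq> V"
  proof
    fix x assume "x \<in> N"
    then have "\<forall>u\<in>U. inv u \<otimes> x \<otimes> u \<in> V" "x \<in> carrier G" by (simp_all add: N_def)
    from bspec[OF this(1) U.one_closed] this(2) show "x \<in> V" by simp
  qed
  have sub: "subgroup N G"
  proof (rule subgroupI)
    have "\<one> \<in> N" by (simp add: N_def)
    then show "N \<noteq> {}" by blast
    show "inv x \<in> N" if x: "x \<in> N" for x
    proof -
      have xG: "x \<in> carrier G" using x by (simp add: N_def)
      have "inv u \<otimes> inv x \<otimes> u \<in> V" if u: "u \<in> U" for u
      proof -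
        have "inv (inv u \<otimes> x \<otimes> u) \<in> V" using x u by (simp add: N_def)
        then show ?thesis using xG u by (simp add: inv_mult_group m_assoc)
      qed
      then show ?thesis using xG by (simp add: N_def)
    qed
    show "x \<otimes> y \<in> N" if xy: "x \<in> N" "y \<in> N" for x y
    proof -
      have xG: "x \<in> carrier G" and yG: "y \<in> carrier G" using xy by (simp_all add: N_def)
      have "inv u \<otimes> (x \<otimes> y) \<otimes> u \<in> V" if u: "u \<in> U" for u
      proof -
        have "(inv u \<otimes> x \<otimes> u) \<otimes> (inv u \<otimes> y \<otimes> u) \<in> V" using xy u by (simp add: N_def)
        then show ?thesis using xG yG u by (simp add: m_assoc inv_mult_cancel)
      qed
      then show ?thesis using xG yG by (simp add: N_def)
    qed
  qed (auto simp: N_def)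
  have norm: "u \<otimes> n \<otimes> inv u \<in> N" if u: "u \<in> U" and n: "n \<in> N" for u n
  proof -
    have nG: "n \<in> carrier G" using n by (simp add: N_def)
    have "inv w \<otimes> (u \<otimes> n \<otimes> inv u) \<otimes> w \<in> V" if w: "w \<in> U" for w
    proof -
      have "inv (inv u \<otimes> w) \<otimes> n \<otimes> (inv u \<otimes> w) \<in> V" using n u w by (simp add: N_def)
      then show ?thesis using nG u w by (simp add: inv_mult_group m_assoc)
    qed
    then show ?thesis using nG u by (simp add: N_def)
  qed
  have "finite ((\<lambda>u. u <# V) ` U)"
    using compact_open_subgroupD(3)[OF U] compact_open_subgroupD(1,2)[OF V] by (rule finite_l_cosets_compactin)
  then obtain E where E: "finite E" "E \<subseteq> U" "(\<lambda>u. u <# V) ` U = (\<lambda>u. u <# V) ` E"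
    by (metis finite_subset_image subset_refl)
  have "N = \<Inter> (insert (carrier G) ((\<lambda>e. {x \<in> carrier G. inv e \<otimes> x \<otimes> e \<in> V}) ` E))" (is "N = ?I")
  proof (intro equalityI subsetI)
    show "x \<in> ?I" if "x \<in> N" for x using that E(2) by (auto simp: N_def)
    fix x assume x: "x \<in> ?I"
    then have xG: "x \<in> carrier G" by simp
    have "inv u \<otimes> x \<otimes> u \<in> V" if u: "u \<in> U" for u
    proof -
      have "u <# V \<in> (\<lambda>u. u <# V) ` E" using u E(3) by blast
      then obtain e where e: "e \<in> E" "e <# V = u <# V" by auto
      have eG: "e \<in> carrier G" and uG: "u \<in> carrier G" using e E(2) u by auto
      have w: "inv e \<otimes> u \<in> V" using e(2) eG uG by (simp add: subgroup_l_coset_eq_iff[OF V.subgroup_axioms])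
      have "inv e \<otimes> x \<otimes> e \<in> V" using x e by simp
      then have "inv (inv e \<otimes> u) \<otimes> (inv e \<otimes> x \<otimes> e) \<otimes> (inv e \<otimes> u) \<in> V" using w by simp
      then show ?thesis using xG eG uG by (simp add: inv_mult_group m_assoc inv_mult_cancel)
    qed
    then show "x \<in> N" using xG by (simp add: N_def)
  qed
  moreover have "openin T ?I"
  proof (rule openin_Inter)
    show "openin T S" if "S \<in> insert (carrier G) ((\<lambda>e. {x \<in> carrier G. inv e \<otimes> x \<otimes> e \<in> V}) ` E)" for S
      using that E(2) compact_open_subgroupD(2)[OF V] openin_carrier
      by (auto intro!: openin_preimage group_continuous_intros)
  qed (use E(1) in auto)
  ultimately have op: "openin T N" by simp
  have "compactin T N"
    using compact_open_subgroupD(3)[OF V] NV open_subgroup_closedin[OF sub op] by (rule closed_compactin)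
  then show ?thesis using that sub op NV norm by (simp add: compact_open_subgroup_def)
qed

end

section \<open>Densities of invariant sets and the zero-one law\<close>

context homogeneous_prob
begin

lemma proj_events: "openin T U \<Longrightarrow> proj ` U \<in> events"
  by (intro openin_sets openin_proj)

lemma prob_Int_translate:
  assumes A: "A \<in> events" "defect A g = 0" and g: "g \<in> carrier G" and B: "B \<in> events"
  shows "prob (A \<inter> translate g B) = prob (A \<inter> B)"
proof -
  have sub: "A \<subseteq> space M" "B \<subseteq> space M" using A B sets.sets_into_space by auto
  have gs: "translate g A \<in> events" "translate g B \<in> events" using g A B by auto
  have null: "sym_diff (translate g A) A \<in> null_sets M"
    using A gs by (auto simp: defect_def null_sets_def emeasure_eq_measure)
  have "AE C in M. C \<in> A \<inter> translate g B \<longleftrightarrow> C \<in> translate g A \<inter> translate g B"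
    using AE_not_in[OF null] by eventually_elim auto
  then have "prob (A \<inter> translate g B) = prob (translate g A \<inter> translate g B)"
    using A gs by (intro finite_measure_eq_AE) auto
  also have "\<dots> = prob (translate g (A \<inter> B))" using g sub by (simp add: translate_Int)
  also have "\<dots> = prob (A \<inter> B)" using g A B by (intro prob_translate) auto
  finally show ?thesis .
qed

text \<open>For \<open>N\<close> normal in \<open>U\<close>, the \<open>N\<close>-orbits in \<open>UH/H\<close> are permuted transitively by \<open>U\<close>, so
  they all carry the same share of an invariant set.\<close>

lemma prob_normal_orbits:
  assumes U: "compact_open_subgroup U" and N: "compact_open_subgroup N" "N \<subseteq> U"
    and norm: "\<And>u n. u \<in> U \<Longrightarrow> n \<in> N \<Longrightarrow> u \<otimes> n \<otimes> inv u \<in> N"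
  obtains k :: nat where "\<And>A. A \<in> events \<Longrightarrow> (\<And>g. g \<in> carrier G \<Longrightarrow> defect A g = 0) \<Longrightarrow>
    prob (A \<inter> proj ` U) = real k * prob (A \<inter> proj ` N)"
proof -
  interpret U: subgroup U G using U by (rule compact_open_subgroupD)
  interpret N: subgroup N G using N(1) by (rule compact_open_subgroupD)
  define F where "F = (\<lambda>u. translate u (proj ` N)) ` U"
  have F_eq: "F = (\<lambda>C. proj ` C) ` (\<lambda>u. u <# N) ` U"
    unfolding F_def image_image[of "\<lambda>C. proj ` C"]
    by (intro image_cong refl) (simp add: translate_proj N.subset)
  have "finite ((\<lambda>u. u <# N) ` U)"
    using compact_open_subgroupD(3)[OF U] compact_open_subgroupD(1,2)[OF N(1)] by (rule finite_l_cosets_compactin)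
  then have finF: "finite F" unfolding F_eq by (rule finite_imageI)
  have Ns: "proj ` N \<in> events" using compact_open_subgroupD(2)[OF N(1)] by (rule proj_events)
  have Fs: "D \<in> events" if "D \<in> F" for D using that Ns by (auto simp: F_def)
  \<comment> \<open>Orbits that meet coincide: \<open>C\<close> is reached from the common point by
    some \<open>z\<close> in the conjugate of \<open>N\<close> by \<open>u\<close>, which lies in
    \<open>N\<close>; conjugating \<open>z\<close> by \<open>inv w\<close> moves it past
    \<open>w\<close>.\<close>
  have sub: "translate u (proj ` N) \<subseteq> translate w (proj ` N)"
    if uw: "u \<in> U" "w \<in> U" and meet: "translate u (proj ` N) \<inter> translate w (proj ` N) \<noteq> {}" for u w
  proof
    have uG: "u \<in> carrier G" and wG: "w \<in> carrier G" using uw by auto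
    fix C assume "C \<in> translate u (proj ` N)"
    then obtain m where m: "m \<in> N" "C = proj (u \<otimes> m)" using uG by (auto simp: act_proj)
    obtain n n' where n: "n \<in> N" "n' \<in> N" "u <# proj n = w <# proj n'" using meet by blast
    have nG: "m \<in> carrier G" "n \<in> carrier G" "n' \<in> carrier G" using m n by auto
    have pn: "proj (u \<otimes> n) = proj (w \<otimes> n')" using n(3) uG wG nG by (simp add: act_proj)
    define z where "z = u \<otimes> (m \<otimes> inv n) \<otimes> inv u"
    have z: "z \<in> N" unfolding z_def using m n uw by (intro norm) auto
    then have zG: "z \<in> carrier G" by auto
    have "proj (u \<otimes> m) = proj (z \<otimes> (u \<otimes> n))"
      using uG nG by (simp add: z_def m_assoc inv_mult_cancel)
    also have "\<dots> = z <# proj (u \<otimes> n)" using zG uG nG by (simp add: act_proj)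
    also have "\<dots> = z <# proj (w \<otimes> n')" by (simp only: pn)
    also have "\<dots> = w <# proj ((inv w \<otimes> z \<otimes> inv (inv w)) \<otimes> n')"
      using zG wG nG by (simp add: act_proj m_assoc inv_mult_cancel)
    finally have "C = w <# proj ((inv w \<otimes> z \<otimes> inv (inv w)) \<otimes> n')" using m(2) by simp
    moreover have "(inv w \<otimes> z \<otimes> inv (inv w)) \<otimes> n' \<in> N"
      using z uw n by (intro N.m_closed norm) auto
    ultimately show "C \<in> translate w (proj ` N)" by blast
  qed
  have disj: "D \<inter> E = {}" if DE: "D \<in> F" "E \<in> F" "D \<noteq> E" for D E
  proof (rule ccontr)
    assume ne: "D \<inter> E \<noteq> {}"
    obtain u w where uw: "u \<in> U" "w \<in> U" "D = translate u (proj ` N)" "E = translate w (proj ` N)"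
      using DE(1,2) unfolding F_def by blast
    have "D \<subseteq> E" "E \<subseteq> D" using sub[OF uw(1,2)] sub[OF uw(2,1)] ne uw by (auto simp: Int_commute)
    then show False using DE(3) by simp
  qed
  have "\<Union>F = proj ` U"
  proof (intro equalityI subsetI)
    fix C assume "C \<in> \<Union>F"
    then obtain u n where un: "u \<in> U" "n \<in> N" "C = u <# proj n" by (auto simp: F_def)
    then have "C = proj (u \<otimes> n)" using N(2) by (auto simp: act_proj)
    then show "C \<in> proj ` U" using un N(2) by auto
  next
    fix C assume "C \<in> proj ` U"
    then obtain u where u: "u \<in> U" "C = proj u" by auto
    then have "C = u <# proj \<one>" by (simp add: act_proj)
    then have "C \<in> translate u (proj ` N)" using N.one_closed by blast
    then show "C \<in> \<Union>F" using u by (auto simp: F_def)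
  qed
  \<comment> \<open>The factor counts the orbits and is the same for all \<open>A\<close>, so it may
    also be evaluated on the whole space.\<close>
  have "prob (A \<inter> proj ` U) = real (card F) * prob (A \<inter> proj ` N)"
    if A: "A \<in> events" "\<And>g. g \<in> carrier G \<Longrightarrow> defect A g = 0" for A
  proof -
    have "A \<inter> proj ` U = (\<Union>D\<in>F. A \<inter> D)" using \<open>\<Union>F = proj ` U\<close> by auto
    also have "prob \<dots> = (\<Sum>D\<in>F. prob (A \<inter> D))"
    proof (rule finite_measure_finite_Union[OF finF])
      show "(\<lambda>D. A \<inter> D) ` F \<subseteq> events" using A Fs by auto
      show "disjoint_family_on (\<lambda>D. A \<inter> D) F"
        unfolding disjoint_family_on_def using disj by blast
    qed
    also have "\<dots> = (\<Sum>D\<in>F. prob (A \<inter> proj ` N))"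
    proof (intro sum.cong refl)
      fix D assume "D \<in> F"
      then obtain u where "u \<in> U" "D = translate u (proj ` N)" by (auto simp: F_def)
      then show "prob (A \<inter> D) = prob (A \<inter> proj ` N)" using A Ns by (auto intro!: prob_Int_translate)
    qed
    finally show ?thesis by simp
  qed
  then show ?thesis by (rule that)
qed

lemma defect_space: "g \<in> carrier G \<Longrightarrow> defect (space M) g = 0"
proof -
  assume g: "g \<in> carrier G"
  have "translate g (space M) = space M"
    using mem_translate_iff[OF g subset_refl] g by auto
  then show ?thesis by (simp add: defect_def)
qed

lemma prob_proj_pos: "compact_open_subgroup U \<Longrightarrow> prob (proj ` U) > 0"
  using compact_open_subgroupD(1,2)[of U] subgroup.one_closed[of U G]
  by (intro prob_open_pos openin_proj) auto

text \<open>By \<open>prob_normal_orbits\<close>, for \<open>A\<close> and for the whole space,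
  passing to a subgroup normalised by \<open>U\<close> keeps the density. Arbitrary \<open>U\<close>
  and \<open>V\<close> are joined by a chain: \<open>N\<close> inside \<open>U \<inter> V\<close> is
  normalised by \<open>U\<close>, and \<open>L\<close> inside \<open>N\<close> is normalised by
  \<open>V\<close>, hence also by \<open>N\<close>.\<close>

lemma density_constant:
  assumes A: "A \<in> events" "\<And>g. g \<in> carrier G \<Longrightarrow> defect A g = 0"
  obtains r where "0 \<le> r" "r \<le> 1"
    "\<And>U. compact_open_subgroup U \<Longrightarrow> prob (A \<inter> proj ` U) = r * prob (proj ` U)"
proof -
  define d where "d U = prob (A \<inter> proj ` U) / prob (proj ` U)" for U
  have normal: "d U = d N" if U: "compact_open_subgroup U" and N: "compact_open_subgroup N" "N \<subseteq> U"
    and norm: "\<And>u n. u \<in> U \<Longrightarrow> n \<in> N \<Longrightarrow> u \<otimes> n \<otimes> inv u \<in> N" for U N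
  proof -
    obtain k :: nat where k: "\<And>A. A \<in> events \<Longrightarrow> (\<And>g. g \<in> carrier G \<Longrightarrow> defect A g = 0) \<Longrightarrow>
        prob (A \<inter> proj ` U) = real k * prob (A \<inter> proj ` N)"
      using prob_normal_orbits[OF U N norm] by blast
    have sub: "space M \<inter> proj ` U = proj ` U" "space M \<inter> proj ` N = proj ` N"
      using compact_open_subgroupD(5)[OF U] N(2) by (auto simp: space_eq_image)
    have kU: "prob (proj ` U) = real k * prob (proj ` N)"
      using k[OF sets.top defect_space] by (simp add: sub)
    then have "k \<noteq> 0" using prob_proj_pos[OF U] by (intro notI) simp
    then show ?thesis unfolding d_def kU using k[OF A] by simp
  qed
  have "d U = d V" if U: "compact_open_subgroup U" and V: "compact_open_subgroup V" for U V
  proof -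
    obtain N where N: "compact_open_subgroup N" "N \<subseteq> U \<inter> V" "\<And>u n. u \<in> U \<Longrightarrow> n \<in> N \<Longrightarrow> u \<otimes> n \<otimes> inv u \<in> N"
      using normal_core[OF U compact_open_subgroup_Int[OF U V]] by blast
    obtain L where L: "compact_open_subgroup L" "L \<subseteq> N" "\<And>u n. u \<in> V \<Longrightarrow> n \<in> L \<Longrightarrow> u \<otimes> n \<otimes> inv u \<in> L"
      using normal_core[OF V N(1)] by blast
    have "d U = d N" using U N by (intro normal) auto
    also have "d N = d L" using N L by (intro normal) auto
    also have "d L = d V" using V L N by (intro normal[symmetric]) auto
    finally show ?thesis .
  qed
  moreover obtain U where U: "compact_open_subgroup U"
    using compact_open_subgroup_base[OF openin_carrier one_closed]
    unfolding compact_open_subgroup_def by blast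
  ultimately have dU: "d V = d U" if "compact_open_subgroup V" for V using that by blast
  show ?thesis
  proof (rule that[of "d U"])
    show "0 \<le> d U" by (simp add: d_def)
    have "prob (A \<inter> proj ` U) \<le> prob (proj ` U)"
      using compact_open_subgroupD(2)[OF U] by (intro finite_measure_mono proj_events) auto
    then show "d U \<le> 1" using prob_proj_pos[OF U] by (simp add: d_def)
    show "prob (A \<inter> proj ` V) = d U * prob (proj ` V)" if V: "compact_open_subgroup V" for V
      using dU[OF V] prob_proj_pos[OF V] by (simp add: d_def field_simps)
  qed
qed

text \<open>The orbit of \<open>V\<close> through \<open>proj x\<close> is the translate by
  \<open>x\<close> of the orbit through \<open>proj \<one>\<close> of the conjugate
  \<open>W\<close>, for which the density is known.\<close>

lemma density_orbit:
  assumes A: "A \<in> events" "\<And>g. g \<in> carrier G \<Longrightarrow> defect A g = 0"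
    and r: "\<And>U. compact_open_subgroup U \<Longrightarrow> prob (A \<inter> proj ` U) = r * prob (proj ` U)"
    and V: "compact_open_subgroup V" and x: "x \<in> carrier G"
  shows "prob (A \<inter> proj ` (V #> x)) = r * prob (proj ` (V #> x))"
proof -
  define W where "W = {y \<in> carrier G. x \<otimes> y \<otimes> inv x \<in> V}"
  have W: "compact_open_subgroup W" unfolding W_def using V x by (rule compact_open_subgroup_conjugate)
  have VG: "V \<subseteq> carrier G" and WG: "W \<subseteq> carrier G" using V W compact_open_subgroupD(5) by auto
  have "V #> x = x <# W"
    using x VG WG by (auto simp: mem_r_coset_iff mem_l_coset_iff W_def inv_mult_cancel)
  then have eq: "proj ` (V #> x) = translate x (proj ` W)" using x WG by (simp add: translate_proj)
  have Ws: "proj ` W \<in> events" using W compact_open_subgroupD(2) proj_events by blast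
  show ?thesis
    unfolding eq using prob_Int_translate[OF A(1) A(2)[OF x] x Ws] prob_translate[OF x Ws] r[OF W] by simp
qed

text \<open>Let \<open>Z\<close> be a finite union of small orbits covering \<open>K\<close>. It
  misses \<open>K'\<close>, so hardly any of it lies outside \<open>A\<close>, yet the share outside
  \<open>A\<close> is exactly \<open>1 - r\<close>. Since \<open>Z\<close> nearly exhausts
  \<open>A\<close> in measure, \<open>(1 - r) * prob A\<close> is arbitrarily small.\<close>

lemma density_zero_one:
  assumes A: "A \<in> events" "\<And>g. g \<in> carrier G \<Longrightarrow> defect A g = 0"
    and r: "\<And>U. compact_open_subgroup U \<Longrightarrow> prob (A \<inter> proj ` U) = r * prob (proj ` U)"
    and r01: "0 \<le> r" "r \<le> 1"
  shows "(1 - r) * prob A = 0"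
proof (rule ccontr)
  assume "\<not> ?thesis"
  then have pos: "(1 - r) * prob A > 0" using r01 by (simp add: zero_less_mult_iff less_le)
  \<comment> \<open>The two regularity errors together stay below twice this value, which is the
    quantity assumed positive.\<close>
  define e where "e = (1 - r) * prob A / 2"
  have e: "e > 0" using pos by (simp add: e_def)
  obtain K where K: "compactin X K" "K \<subseteq> A" "prob (A - K) < e" using inner_regular[OF A(1) e] by blast
  obtain K' where K': "compactin X K'" "K' \<subseteq> space M - A" "prob (space M - A - K') < e"
    using inner_regular[of "space M - A" e] A(1) e by auto
  have Ks: "K \<in> events" "K' \<in> events" using K K' compactin_sets by auto
  have "K \<inter> K' = {}" using K(2) K'(2) by blast
  then obtain V where V: "subgroup V G" "openin T V" "compactin T V"
    "\<And>v. v \<in> V \<Longrightarrow> translate v K \<inter> K' = {}"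
    using separate_compact[OF K(1) K'(1)] by blast
  then have cV: "compact_open_subgroup V" by (simp add: compact_open_subgroup_def)
  interpret V: subgroup V G by fact
  define Y where "Y = {x \<in> carrier G. proj x \<in> K}"
  define P where "P x = proj ` (V #> x)" for x
  have Pop: "openin X (P x)" if "x \<in> Y" for x
    unfolding P_def using that V(2) by (intro openin_proj openin_r_coset) (auto simp: Y_def)
  have P_mem: "C \<in> P x \<longleftrightarrow> (\<exists>v\<in>V. C = proj (v \<otimes> x))" for C x
    by (auto simp: P_def r_coset_def)
  \<comment> \<open>Orbits of \<open>V\<close> coincide or are disjoint, so a finite cover by orbits
    is already a partition and measures add up.\<close>
  have P_sub: "P x \<subseteq> P y" if xy: "x \<in> carrier G" "y \<in> carrier G" "P x \<inter> P y \<noteq> {}" for x y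
  proof
    fix C assume "C \<in> P x"
    then obtain u where u: "u \<in> V" "C = proj (u \<otimes> x)" by (auto simp: P_mem)
    obtain v w where vw: "v \<in> V" "w \<in> V" "proj (v \<otimes> x) = proj (w \<otimes> y)"
      using xy(3) unfolding P_mem[abs_def] disjoint_iff by (metis P_mem)
    have G: "u \<in> carrier G" "v \<in> carrier G" "w \<in> carrier G" using u vw by auto
    have "C = (u \<otimes> inv v) <# proj (v \<otimes> x)"
      using u G xy by (simp add: act_proj m_assoc inv_mult_cancel)
    also have "\<dots> = proj ((u \<otimes> inv v \<otimes> w) \<otimes> y)" using vw G xy by (simp add: act_proj m_assoc)
    finally show "C \<in> P y" using u vw unfolding P_mem by blast
  qed
  have "K \<subseteq> \<Union> (P ` Y)"
  proof
    fix C assume C: "C \<in> K"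
    then obtain x where x: "x \<in> carrier G" "C = proj x" using compactin_sub[OF K(1)] space_cases by blast
    then have "C = proj (\<one> \<otimes> x)" by simp
    then have "C \<in> P x" using V.one_closed unfolding P_mem by blast
    moreover have "x \<in> Y" using x C by (simp add: Y_def)
    ultimately show "C \<in> \<Union> (P ` Y)" by blast
  qed
  then obtain F where F: "finite F" "F \<subseteq> P ` Y" "K \<subseteq> \<Union>F"
    using compactinD[OF K(1), of "P ` Y"] Pop by blast
  have Fs: "D \<in> events" if "D \<in> F" for D using that F(2) Pop openin_sets by auto
  have disj: "D \<inter> E = {}" if DE: "D \<in> F" "E \<in> F" "D \<noteq> E" for D E
  proof (rule ccontr)
    assume ne: "D \<inter> E \<noteq> {}"
    obtain x y where xy: "x \<in> Y" "y \<in> Y" "D = P x" "E = P y" using DE(1,2) F(2) by blast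
    then have "D \<subseteq> E" "E \<subseteq> D" using P_sub[of x y] P_sub[of y x] ne by (auto simp: Y_def Int_commute)
    then show False using DE(3) by simp
  qed
  define Z where "Z = \<Union>F"
  have Zs: "Z \<in> events" unfolding Z_def using F(1) Fs by auto
  have "prob (A \<inter> Z) = (\<Sum>D\<in>F. prob (A \<inter> D))"
  proof -
    have "A \<inter> Z = (\<Union>D\<in>F. A \<inter> D)" by (auto simp: Z_def)
    moreover have "prob (\<Union>D\<in>F. A \<inter> D) = (\<Sum>D\<in>F. prob (A \<inter> D))"
    proof (rule finite_measure_finite_Union[OF F(1)])
      show "(\<lambda>D. A \<inter> D) ` F \<subseteq> events" using A Fs by auto
      show "disjoint_family_on (\<lambda>D. A \<inter> D) F"
        unfolding disjoint_family_on_def using disj by blast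
    qed
    ultimately show ?thesis by simp
  qed
  also have "\<dots> = (\<Sum>D\<in>F. r * prob D)"
  proof (intro sum.cong refl)
    fix D assume "D \<in> F"
    then obtain x where "x \<in> Y" "D = P x" using F(2) by blast
    then show "prob (A \<inter> D) = r * prob D"
      unfolding P_def using density_orbit[OF A r cV] by (simp add: Y_def)
  qed
  also have "\<dots> = r * prob (\<Union>D\<in>F. D)"
  proof -
    have "prob (\<Union>D\<in>F. D) = (\<Sum>D\<in>F. prob D)"
    proof (rule finite_measure_finite_Union[OF F(1)])
      show "(\<lambda>D. D) ` F \<subseteq> events" using Fs by auto
      show "disjoint_family_on (\<lambda>D. D) F" unfolding disjoint_family_on_def using disj by blast
    qed
    then show ?thesis by (simp add: sum_distrib_left)
  qed
  finally have AZ: "prob (A \<inter> Z) = r * prob Z" by (simp add: Z_def)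
  have "Z \<inter> K' = {}"
  proof (rule ccontr)
    assume "Z \<inter> K' \<noteq> {}"
    then obtain C D where CD: "D \<in> F" "C \<in> D" "C \<in> K'" by (auto simp: Z_def)
    then obtain x where x: "x \<in> Y" "C \<in> P x" using F(2) by blast
    then obtain v where v: "v \<in> V" "C = proj (v \<otimes> x)" unfolding P_mem by blast
    then have "C = v <# proj x" using x by (simp add: act_proj Y_def)
    then have "C \<in> translate v K" using x by (simp add: Y_def)
    then show False using V(4)[OF v(1)] CD(3) by blast
  qed
  then have "Z - A \<subseteq> space M - A - K'" using sets.sets_into_space[OF Zs] by blast
  then have "prob (Z - A) \<le> prob (space M - A - K')" using A(1) Ks by (intro finite_measure_mono) auto
  moreover have "prob Z = prob (A \<inter> Z) + prob (Z - A)"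
  proof -
    have "Z = (A \<inter> Z) \<union> (Z - A)" by blast
    moreover have "prob ((A \<inter> Z) \<union> (Z - A)) = prob (A \<inter> Z) + prob (Z - A)"
      using A(1) Zs by (intro finite_measure_Union) auto
    ultimately show ?thesis by simp
  qed
  ultimately have 1: "(1 - r) * prob Z < e" using AZ K'(3) by (simp add: left_diff_distrib)
  have "prob (A - K) = prob A - prob K" using A(1) Ks K(2) by (intro finite_measure_Diff) auto
  moreover have "prob K \<le> prob Z" using F(3) Zs by (intro finite_measure_mono) (auto simp: Z_def)
  ultimately have "prob A - prob Z < e" using K(3) by linarith
  then have "(1 - r) * (prob A - prob Z) \<le> (1 - r) * e" using r01 by (intro mult_left_mono) auto
  also have "\<dots> \<le> 1 * e" using r01 e by (intro mult_right_mono) auto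
  finally have "(1 - r) * (prob A - prob Z) \<le> e" by simp
  with 1 have "(1 - r) * prob A < 2 * e" by (simp add: right_diff_distrib)
  then show False by (simp add: e_def)
qed

lemma defect_compl:
  assumes "A \<in> events" "g \<in> carrier G" shows "defect (space M - A) g = defect A g"
proof -
  have A: "A \<subseteq> space M" using assms(1) by (rule sets.sets_into_space)
  have "translate g (space M) = space M"
    using mem_translate_iff[OF assms(2) subset_refl] assms(2) by auto
  then have "translate g (space M - A) = space M - translate g A"
    using translate_Diff[OF assms(2) subset_refl A] by simp
  moreover have "translate g A \<subseteq> space M" using assms(2) A by (rule translate_subset)
  ultimately have "sym_diff (translate g (space M - A)) (space M - A) = sym_diff (translate g A) A"
    using A by auto
  then show ?thesis by (simp add: defect_def)
qed

text \<open>The complement has density \<open>1 - r\<close>. Applying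
  \<open>density_zero_one\<close> to both sets shows that \<open>A\<close> is null unless
  \<open>r = 1\<close>, and that its complement is null unless \<open>r = 0\<close>.\<close>

lemma invariant_trivial:
  assumes A: "A \<in> events" "\<And>g. g \<in> carrier G \<Longrightarrow> defect A g = 0"
  shows "A \<in> null_sets M \<or> space M - A \<in> null_sets M"
proof -
  obtain r where r: "0 \<le> r" "r \<le> 1"
    "\<And>U. compact_open_subgroup U \<Longrightarrow> prob (A \<inter> proj ` U) = r * prob (proj ` U)"
    using density_constant[OF A] by blast
  let ?B = "space M - A"
  have B: "?B \<in> events" "\<And>g. g \<in> carrier G \<Longrightarrow> defect ?B g = 0"
    using A by (auto simp: defect_compl)
  have "prob (?B \<inter> proj ` U) = (1 - r) * prob (proj ` U)" if U: "compact_open_subgroup U" for U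
  proof -
    have Us: "proj ` U \<in> events" using compact_open_subgroupD(2)[OF U] by (rule proj_events)
    then have "?B \<inter> proj ` U = proj ` U - A \<inter> proj ` U" using sets.sets_into_space[OF Us] by blast
    then have "prob (?B \<inter> proj ` U) = prob (proj ` U) - prob (A \<inter> proj ` U)"
      using Us A(1) by (simp add: finite_measure_Diff)
    then show ?thesis using r(3)[OF U] by (simp add: left_diff_distrib)
  qed
  then have "(1 - (1 - r)) * prob ?B = 0" using r(1,2) by (intro density_zero_one[OF B]) auto
  moreover have "(1 - r) * prob A = 0" using A r(3,1,2) by (rule density_zero_one)
  ultimately have "prob A = 0 \<or> prob ?B = 0" by auto
  then show ?thesis using A(1) B(1) by (auto simp: null_sets_def emeasure_eq_measure)
qed

end

theorem corollary1p16:
  fixes G (structure) and T :: "'a topology"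
  assumes "tdlc_group G T"
    and "metrizable_space T"
  shows "(T closure_of Tits_core G T = carrier G \<longleftrightarrow> Hausdorff_quotients_contract G T) \<and>
    (T closure_of Tits_core G T = carrier G \<longrightarrow>
      (\<forall>H M. subgroup H G \<and> closedin T H \<and> finite_covolume G T H \<and> invariant_prob G T H M \<longrightarrow>
        acts_ergodically H (\<lambda>h C. h <# C) M))"
proof (intro conjI impI allI)
  interpret tdlc_group G T by fact
  \<comment> \<open>Metrizability enters as a countable base at \<open>\<one>\<close>, along which
    limits are lifted.\<close>
  have "first_countable T" using assms(2) by (rule metrizable_imp_first_countable)
  then show "T closure_of Tits_core G T = carrier G \<longleftrightarrow> Hausdorff_quotients_contract G T"
    using Hausdorff_quotients_contract_if_dense_Tits_core dense_Tits_core_if_Hausdorff_quotients_contract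
    by blast
  fix H M
  assume dense: "T closure_of Tits_core G T = carrier G"
    and H: "subgroup H G \<and> closedin T H \<and> finite_covolume G T H \<and> invariant_prob G T H M"
  interpret homogeneous_prob G T H M
    using H assms(1) by (simp add: homogeneous_prob_def homogeneous_prob_axioms_def)
  show "acts_ergodically H (\<lambda>h C. h <# C) M"
    unfolding acts_ergodically_def
  proof (intro ballI impI)
    fix A assume A: "A \<in> sets M" and inv: "\<forall>s\<in>H. sym_diff (translate s A) A \<in> null_sets M"
    have "defect A h = 0" if "h \<in> H" for h
      using inv that by (auto simp: defect_def measure_eq_0_null_sets)
    \<comment> \<open>Density of the core extends almost invariance from \<open>H\<close> to the
      whole group, where the zero-one law applies.\<close>
    then have "defect A g = 0" if "g \<in> carrier G" for g
      using defect_eq_0[OF dense A _ that] by blast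
    then show "A \<in> null_sets M \<or> space M - A \<in> null_sets M" using A by (intro invariant_trivial)
  qed
qed

end
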